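(* Let $(p_m)_{m}$ be a sequence of prime numbers with $p_m\to\infty$ and let $(k_m)_m$ be a sequence of positive integers with $k_m<p_m$ for all $m$. Write $p=p_m$, $k=k_m$, and let $d(t)=d_m(t)$ be the worst-case total variation distance after $t$ steps of the Sylow--Burnside process on $S_{pk}$ (with respect to a Sylow $p$-subgroup of $S_{pk}$). Then, as $m\to\infty$: 1. If $k_m$ is eventually constant equal to $k$, then for all $c\ge 0$, $$d(cp)\to 1-(1-e^{-c})^k.$$ 2. If $k_m\to\infty$, then for all $c\in\mathbb{R}$, $$d(p\log k+cp)\to 1-\exp(-e^{-c}).$$
   Context: Let $p$ be prime, $1\le k<p$, and let $H\subseteq S_{pk}$ be a Sylow $p$-subgroup of the symmetric group $S_{pk}$. The group $H\times H$ acts on $S_{pk}$ by $\sigma^{h,g}=h^{-1}\sigma g$; the orbits are the double cosets $H\sigma H$. Let $(H\times H)_\sigma=\{(h,g):\sigma^{h,g}=\sigma\}$ and $S_{pk}^{h,g}=\{\tau\in S_{pk}:\tau^{h,g}=\tau\}$. The Sylow--Burnside process is the Markov chain on $S_{pk}$ with transition kernel $$P(\sigma,\tau)=\frac{1}{|(H\times H)_\sigma|}\sum_{(h,g)\in (H\times H)_\sigma\cap(H\times H)_\tau}\frac{1}{|S_{pk}^{h,g}|}.$$ That is, from $\sigma$ choose $(h,g)$ uniformly from $(H\times H)_\sigma$, then choose $\tau$ uniformly from $S_{pk}^{h,g}$. Its unique stationary distribution is $\pi(\sigma)=\frac{1}{Z|H\sigma H|}$, where $Z$ is the number of double cosets $H\sigma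 H$ in $S_{pk}$. $P^t_\sigma$ denotes the distribution of the chain after $t$ steps started at $\sigma$ (with $P^0_\sigma$ the point mass at $\sigma$). Total variation distance is $\Vert\mu-\nu\Vert_{\mathrm{TV}}=\frac12\sum_x|\mu(x)-\nu(x)|$. For integers $t\ge0$, $d(t)=\max_{\sigma\in S_{pk}}\Vert P^t_\sigma-\pi\Vert_{\mathrm{TV}}$, and $d(t)=d(\lfloor t\rfloor)$ for noninteger $t\ge 0$. (In part 2 the argument $p\log k+cp$ is nonnegative for all large $m$, so the limit makes sense.) *)

theory Defs
  imports Complex_Main "HOL-Algebra.Sym_Groups" "HOL-Algebra.Coset"
    "HOL-Computational_Algebra.Primes"
begin

definition sylow_subgroup :: "nat \<Rightarrow> ('a, 'b) monoid_scheme \<Rightarrow> 'a set \<Rightarrow> bool" where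
  "sylow_subgroup p G H \<longleftrightarrow> subgroup H G \<and> card H = p ^ multiplicity p (order G)"

text \<open>
  The Burnside process for the action of \<open>H \<times> H\<close> on \<open>G\<close>, for a subgroup \<open>H\<close> of a finite
  group \<open>G\<close>. The action \<open>(h, g) \<mapsto> h\<^sup>-\<^sup>1 \<sigma> g\<close> is a right action of \<open>H \<times> H\<close>, so the left
  actions of \<open>HOL-Algebra.Group_Action\<close> do not apply directly.
\<close>

definition dc_act :: "('a, 'b) monoid_scheme \<Rightarrow> 'a \<Rightarrow> 'a \<Rightarrow> 'a \<Rightarrow> 'a" where
  "dc_act G h g \<sigma> = inv\<^bsub>G\<^esub> h \<otimes>\<^bsub>G\<^esub> \<sigma> \<otimes>\<^bsub>G\<^esub> g"

definition dc_stab :: "('a, 'b) monoid_scheme \<Rightarrow> 'a set \<Rightarrow> 'a \<Rightarrow> ('a \<times> 'a) set" where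
  "dc_stab G H \<sigma> = {(h, g) \<in> H \<times> H. dc_act G h g \<sigma> = \<sigma>}"

definition dc_fix :: "('a, 'b) monoid_scheme \<Rightarrow> 'a \<Rightarrow> 'a \<Rightarrow> 'a set" where
  "dc_fix G h g = {\<tau> \<in> carrier G. dc_act G h g \<tau> = \<tau>}"

definition double_coset :: "('a, 'b) monoid_scheme \<Rightarrow> 'a set \<Rightarrow> 'a \<Rightarrow> 'a set" where
  "double_coset G H \<sigma> = H <#>\<^bsub>G\<^esub> (\<sigma> <#\<^bsub>G\<^esub> H)"

definition burnside_kernel ::
  "('a, 'b) monoid_scheme \<Rightarrow> 'a set \<Rightarrow> 'a \<Rightarrow> 'a \<Rightarrow> real" where
  "burnside_kernel G H \<sigma> \<tau> =
     1 / real (card (dc_stab G H \<sigma>)) *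
     (\<Sum>(h, g) \<in> dc_stab G H \<sigma> \<inter> dc_stab G H \<tau>. 1 / real (card (dc_fix G h g)))"

text \<open>\<open>burnside_dist G H t \<sigma>\<close> is the distribution on \<open>carrier G\<close> after \<open>t\<close> steps from \<open>\<sigma>\<close>.\<close>

primrec burnside_dist ::
  "('a, 'b) monoid_scheme \<Rightarrow> 'a set \<Rightarrow> nat \<Rightarrow> 'a \<Rightarrow> 'a \<Rightarrow> real" where
  "burnside_dist G H 0 \<sigma> = (\<lambda>\<tau>. if \<tau> = \<sigma> then 1 else 0)"
| "burnside_dist G H (Suc t) \<sigma> =
     (\<lambda>\<tau>. \<Sum>\<rho>\<in>carrier G. burnside_dist G H t \<sigma> \<rho> * burnside_kernel G H \<rho> \<tau>)"

definition burnside_stationary :: "('a, 'b) monoid_scheme \<Rightarrow> 'a set \<Rightarrow> 'a \<Rightarrow> real" where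
  "burnside_stationary G H \<sigma> =
     1 / (real (card (double_coset G H ` carrier G)) * real (card (double_coset G H \<sigma>)))"

definition tv_dist :: "'a set \<Rightarrow> ('a \<Rightarrow> real) \<Rightarrow> ('a \<Rightarrow> real) \<Rightarrow> real" where
  "tv_dist X \<mu> \<nu> = 1 / 2 * (\<Sum>x\<in>X. \<bar>\<mu> x - \<nu> x\<bar>)"

text \<open>
  The worst-case distance at a real time \<open>t \<ge> 0\<close>, with \<open>t\<close> rounded down. For \<open>t < 0\<close>, where
  the distance has no meaning, the truncation in \<open>nat\<close> gives the value at time \<open>0\<close>.
\<close>

definition burnside_d :: "('a, 'b) monoid_scheme \<Rightarrow> 'a set \<Rightarrow> real \<Rightarrow> real" where
  "burnside_d G H t =
     Max ((\<lambda>\<sigma>. tv_dist (carrier G) (burnside_dist G H (nat \<lfloor>t\<rfloor>) \<sigma>) (burnside_stationary G H))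
            ` carrier G)"

end

theory Submission
  imports Defs "HOL-Algebra.Multiplicative_Group" "HOL-Real_Asymp.Real_Asymp"
begin

text \<open>
  A Sylow \<open>p\<close>-subgroup \<open>H\<close> of \<open>S\<^bsub>pk\<^esub>\<close> with \<open>k < p\<close> has exactly \<open>k\<close> orbits of size \<open>p\<close> (blocks), and
  evaluation at one point of each block identifies \<open>H\<close> with the full product of the blocks. If
  \<open>(h, g)\<close> stabilises \<open>\<sigma>\<close>, then \<open>\<sigma>\<close> matches the blocks moved by \<open>g\<close> with those moved by \<open>h\<close>; the
  stabiliser of \<open>\<sigma>\<close> is a product of \<open>j(\<sigma>)\<close> copies of \<open>C\<^sub>p\<close>, one for each matched block. In one step
  every matched block survives independently with probability \<open>1 - 1/p\<close>, and the expected number of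
  newly matched blocks is at most \<open>\<epsilon> = p\<^sup>4 / p!\<close>. Up to errors of order \<open>(t + p) \<epsilon>\<close> the chain is
  therefore a pure death process: it is uniform, hence nearly stationary, once no block is matched,
  and if \<open>\<sigma>'\<close> is one step away from \<open>\<sigma>\<close>, the mean of \<open>x\<close> to the power \<open>j(\<sigma>')\<close> is approximately
  \<open>1/p + (1 - 1/p) x\<close> to the power \<open>j(\<sigma>)\<close>.
  Started at the identity, where \<open>j = k\<close>, the distance after \<open>t\<close> steps is
  \<open>1 - (1 - (1 - 1/p)^t)^k\<close> up to these errors (and a shift of \<open>t\<close> by one).
\<close>

section \<open>The Burnside process on double cosets of a finite group\<close>

locale burnside_process = group G for G (structure) +
  fixes H
  assumes finite_carrier: "finite (carrier G)"
    and subgroup_H: "subgroup H G"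
begin

lemma H_carrier: "h \<in> H \<Longrightarrow> h \<in> carrier G"
  using subgroup_H by (rule subgroup.mem_carrier)

lemma finite_H: "finite H"
  using finite_carrier subgroup.subset[OF subgroup_H] by (rule rev_finite_subset)

lemma one_in_H: "\<one> \<in> H"
  using subgroup_H by (rule subgroup.one_closed)

lemma H_mult: "h \<in> H \<Longrightarrow> g \<in> H \<Longrightarrow> h \<otimes> g \<in> H"
  using subgroup_H by (rule subgroup.m_closed)

lemma H_inv: "h \<in> H \<Longrightarrow> inv h \<in> H"
  using subgroup_H by (rule subgroup.m_inv_closed)

section \<open>Stabilisers, fixed sets and the two-stage form of the kernel\<close>

lemma dc_act_eq_iff:
  assumes "h \<in> H" "g \<in> H" "\<sigma> \<in> carrier G" "\<tau> \<in> carrier G"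
  shows "dc_act G h g \<sigma> = \<tau> \<longleftrightarrow> \<sigma> \<otimes> g = h \<otimes> \<tau>"
  using assms inv_solve_left'[of \<tau> h "\<sigma> \<otimes> g"] H_carrier by (auto simp: dc_act_def m_assoc)

lemma dc_stab_iff:
  assumes "\<sigma> \<in> carrier G"
  shows "x \<in> dc_stab G H \<sigma> \<longleftrightarrow> fst x \<in> H \<and> snd x \<in> H \<and> \<sigma> \<otimes> snd x = fst x \<otimes> \<sigma>"
  using assms dc_act_eq_iff unfolding dc_stab_def by (cases x) auto

lemma dc_fix_iff:
  assumes "h \<in> H" "g \<in> H"
  shows "\<sigma> \<in> dc_fix G h g \<longleftrightarrow> \<sigma> \<in> carrier G \<and> \<sigma> \<otimes> g = h \<otimes> \<sigma>"
  using assms dc_act_eq_iff unfolding dc_fix_def by auto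

lemma dc_stab_sub: "dc_stab G H \<sigma> \<subseteq> H \<times> H"
  unfolding dc_stab_def by auto

lemma finite_dc_stab: "finite (dc_stab G H \<sigma>)"
  using dc_stab_sub finite_H finite_subset by blast

lemma finite_dc_fix: "finite (dc_fix G h g)"
  using finite_carrier unfolding dc_fix_def by auto

lemma one_in_dc_stab:
  assumes "\<sigma> \<in> carrier G"
  shows "(\<one>, \<one>) \<in> dc_stab G H \<sigma>"
  using assms by (simp add: dc_stab_iff one_in_H)

lemma card_dc_stab_pos:
  assumes "\<sigma> \<in> carrier G"
  shows "0 < card (dc_stab G H \<sigma>)"
  using one_in_dc_stab[OF assms] finite_dc_stab card_gt_0_iff by blast

lemma card_dc_fix_pos:
  assumes "\<sigma> \<in> carrier G" "x \<in> dc_stab G H \<sigma>"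
  shows "0 < card (dc_fix G (fst x) (snd x))"
proof -
  have "\<sigma> \<in> dc_fix G (fst x) (snd x)"
    using assms by (simp add: dc_stab_iff dc_fix_iff)
  then show ?thesis
    using finite_dc_fix by (auto simp: card_gt_0_iff)
qed

text \<open>Exchanging the two sums recovers the description of a step by two uniform choices, first
  in the stabiliser and then in the fixed set. One-step expectations are estimated in this
  form.\<close>

lemma sum_kernel:
  assumes \<sigma>: "\<sigma> \<in> carrier G"
  shows "(\<Sum>\<tau>\<in>carrier G. burnside_kernel G H \<sigma> \<tau> * f \<tau>) =
    (\<Sum>x\<in>dc_stab G H \<sigma>. (\<Sum>\<tau>\<in>dc_fix G (fst x) (snd x). f \<tau>) / real (card (dc_fix G (fst x) (snd x))))
      / real (card (dc_stab G H \<sigma>))"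
proof -
  let ?S = "dc_stab G H \<sigma>"
  let ?F = "\<lambda>x. dc_fix G (fst x) (snd x)"
  have "(\<Sum>\<tau>\<in>carrier G. (\<Sum>x\<in>?S \<inter> dc_stab G H \<tau>. 1 / real (card (?F x))) * f \<tau>)
      = (\<Sum>\<tau>\<in>carrier G. \<Sum>x\<in>?S. if \<tau> \<in> ?F x then f \<tau> / real (card (?F x)) else 0)"
  proof (rule sum.cong)
    fix \<tau> assume \<tau>: "\<tau> \<in> carrier G"
    have "(\<Sum>x\<in>?S \<inter> dc_stab G H \<tau>. 1 / real (card (?F x))) * f \<tau>
       = (\<Sum>x\<in>?S \<inter> dc_stab G H \<tau>. f \<tau> / real (card (?F x)))"
      by (simp add: sum_distrib_right)
    also have "\<dots> = (\<Sum>x\<in>?S. if x \<in> dc_stab G H \<tau> then f \<tau> / real (card (?F x)) else 0)"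
      by (simp add: sum.inter_restrict finite_dc_stab)
    also have "\<dots> = (\<Sum>x\<in>?S. if \<tau> \<in> ?F x then f \<tau> / real (card (?F x)) else 0)"
      using \<sigma> \<tau> by (intro sum.cong) (auto simp: dc_stab_iff dc_fix_iff)
    finally show "(\<Sum>x\<in>?S \<inter> dc_stab G H \<tau>. 1 / real (card (?F x))) * f \<tau>
       = (\<Sum>x\<in>?S. if \<tau> \<in> ?F x then f \<tau> / real (card (?F x)) else 0)" .
  qed auto
  also have "\<dots> = (\<Sum>x\<in>?S. \<Sum>\<tau>\<in>carrier G. if \<tau> \<in> ?F x then f \<tau> / real (card (?F x)) else 0)"
    by (rule sum.swap)
  also have "\<dots> = (\<Sum>x\<in>?S. (\<Sum>\<tau>\<in>?F x. f \<tau>) / real (card (?F x)))"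
  proof (rule sum.cong)
    fix x
    have "carrier G \<inter> ?F x = ?F x"
      by (auto simp: dc_fix_def)
    then show "(\<Sum>\<tau>\<in>carrier G. if \<tau> \<in> ?F x then f \<tau> / real (card (?F x)) else 0)
       = (\<Sum>\<tau>\<in>?F x. f \<tau>) / real (card (?F x))"
      using finite_carrier by (simp add: sum.inter_restrict[symmetric] sum_divide_distrib)
  qed auto
  finally show ?thesis
    unfolding burnside_kernel_def case_prod_unfold
    by (simp add: sum_divide_distrib[symmetric])
qed

lemma kernel_nonneg: "0 \<le> burnside_kernel G H \<sigma> \<tau>"
  unfolding burnside_kernel_def case_prod_unfold by (intro mult_nonneg_nonneg sum_nonneg) auto

lemma kernel_sum_one:
  assumes "\<sigma> \<in> carrier G"
  shows "(\<Sum>\<tau>\<in>carrier G. burnside_kernel G H \<sigma> \<tau>) = 1"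
proof -
  have "(\<Sum>x\<in>dc_stab G H \<sigma>. real (card (dc_fix G (fst x) (snd x))) / real (card (dc_fix G (fst x) (snd x))))
    = (\<Sum>x\<in>dc_stab G H \<sigma>. 1)"
    using card_dc_fix_pos[OF assms] by (intro sum.cong) auto
  then show ?thesis
    using sum_kernel[OF assms, of "\<lambda>_. 1"] card_dc_stab_pos[OF assms] by simp
qed

section \<open>Double cosets as orbits, and the stationary distribution\<close>

lemma double_coset_eq_image:
  assumes \<sigma>: "\<sigma> \<in> carrier G"
  shows "double_coset G H \<sigma> = (\<lambda>x. dc_act G (fst x) (snd x) \<sigma>) ` (H \<times> H)"
proof -
  have eq: "double_coset G H \<sigma> = {h \<otimes> (\<sigma> \<otimes> g) | h g. h \<in> H \<and> g \<in> H}"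
    unfolding double_coset_def set_mult_def l_coset_def by blast
  have 1: "h \<otimes> (\<sigma> \<otimes> g) = dc_act G (inv h) g \<sigma>" if "h \<in> H" "g \<in> H" for h g
    using that \<sigma> H_carrier by (simp add: dc_act_def m_assoc)
  have 2: "dc_act G h g \<sigma> = inv h \<otimes> (\<sigma> \<otimes> g)" if "h \<in> H" "g \<in> H" for h g
    using that \<sigma> H_carrier by (simp add: dc_act_def m_assoc)
  show ?thesis
    unfolding eq
  proof (intro Set.set_eqI iffI)
    fix y assume "y \<in> {h \<otimes> (\<sigma> \<otimes> g) | h g. h \<in> H \<and> g \<in> H}"
    then obtain h g where "h \<in> H" "g \<in> H" "y = h \<otimes> (\<sigma> \<otimes> g)" by blast
    then show "y \<in> (\<lambda>x. dc_act G (fst x) (snd x) \<sigma>) ` (H \<times> H)"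
      using 1 H_inv by (intro image_eqI[of _ _ "(inv h, g)"]) auto
  qed (use 2 H_inv in force)
qed

text \<open>Orbit-stabiliser theorem for \<open>H \<times> H\<close>; it trades double coset sizes
  in the stationary weights for stabiliser sizes.\<close>

lemma card_double_coset:
  assumes \<sigma>: "\<sigma> \<in> carrier G"
  shows "card (double_coset G H \<sigma>) * card (dc_stab G H \<sigma>) = card H ^ 2"
proof -
  let ?a = "\<lambda>x. dc_act G (fst x) (snd x) \<sigma>"
  have fib: "card {x \<in> H \<times> H. ?a x = ?a y} = card (dc_stab G H \<sigma>)" if y: "y \<in> H \<times> H" for y
  proof -
    obtain h0 g0 where y0: "y = (h0, g0)" "h0 \<in> H" "g0 \<in> H" using y by auto
    note carr = H_carrier[OF y0(2)] H_carrier[OF y0(3)]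
    have key: "dc_act G (h \<otimes> h0) (g \<otimes> g0) \<sigma> = dc_act G h0 g0 (dc_act G h g \<sigma>)"
      if "h \<in> H" "g \<in> H" for h g
      using that carr \<sigma> H_carrier by (simp add: dc_act_def m_assoc inv_mult_group)
    have canc: "dc_act G h0 g0 a = dc_act G h0 g0 b \<longleftrightarrow> a = b" if "a \<in> carrier G" "b \<in> carrier G" for a b
      using that carr by (simp add: dc_act_def)
    \<comment> \<open>For a right action, the pairs that move \<sigma> to the same point as
      \<open>y\<close> form the translate of the stabiliser by \<open>y\<close> on the
      right.\<close>
    have "bij_betw (\<lambda>x. (fst x \<otimes> h0, snd x \<otimes> g0)) (dc_stab G H \<sigma>) {x \<in> H \<times> H. ?a x = ?a y}"
    proof (rule bij_betwI[where g = "\<lambda>x. (fst x \<otimes> inv h0, snd x \<otimes> inv g0)"])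
      show "(\<lambda>x. (fst x \<otimes> h0, snd x \<otimes> g0)) \<in> dc_stab G H \<sigma> \<rightarrow> {x \<in> H \<times> H. ?a x = ?a y}"
        using y0 H_mult H_inv key by (auto simp: dc_stab_def)
      show "(\<lambda>x. (fst x \<otimes> inv h0, snd x \<otimes> inv g0)) \<in> {x \<in> H \<times> H. ?a x = ?a y} \<rightarrow> dc_stab G H \<sigma>"
      proof
        fix x assume x: "x \<in> {x \<in> H \<times> H. ?a x = ?a y}"
        then have H: "fst x \<otimes> inv h0 \<in> H" "snd x \<otimes> inv g0 \<in> H"
          using y0 H_mult H_inv by auto
        have "fst x \<in> carrier G" "snd x \<in> carrier G" using x H_carrier by auto
        then have "(fst x \<otimes> inv h0) \<otimes> h0 = fst x" "(snd x \<otimes> inv g0) \<otimes> g0 = snd x"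
          using carr by (auto simp: m_assoc)
        then have "dc_act G h0 g0 (dc_act G (fst x \<otimes> inv h0) (snd x \<otimes> inv g0) \<sigma>) = dc_act G h0 g0 \<sigma>"
          using key[OF H] x y0 by simp
        moreover have "dc_act G (fst x \<otimes> inv h0) (snd x \<otimes> inv g0) \<sigma> \<in> carrier G"
          using H H_carrier \<sigma> by (simp add: dc_act_def)
        ultimately show "(fst x \<otimes> inv h0, snd x \<otimes> inv g0) \<in> dc_stab G H \<sigma>"
          using canc \<sigma> H by (auto simp: dc_stab_def)
      qed
    qed (use carr H_carrier in \<open>auto simp: dc_stab_def m_assoc\<close>)
    then show ?thesis by (simp add: bij_betw_same_card)
  qed
  have "card (H \<times> H) = (\<Sum>z\<in>?a ` (H \<times> H). \<Sum>x\<in>{x \<in> H \<times> H. ?a x = z}. 1)"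
    using finite_H by (subst sum.image_gen[symmetric]) auto
  also have "\<dots> = (\<Sum>z\<in>?a ` (H \<times> H). card (dc_stab G H \<sigma>))"
    by (rule sum.cong) (use fib in auto)
  finally show ?thesis
    by (simp add: double_coset_eq_image[OF \<sigma>] card_cartesian_product power2_eq_square)
qed

lemma double_coset_eq:
  assumes \<sigma>: "\<sigma> \<in> carrier G" and \<tau>: "\<tau> \<in> double_coset G H \<sigma>"
  shows "double_coset G H \<tau> = double_coset G H \<sigma>"
proof -
  obtain h0 g0 where y0: "\<tau> = dc_act G h0 g0 \<sigma>" "h0 \<in> H" "g0 \<in> H"
    using \<tau> double_coset_eq_image[OF \<sigma>] by auto
  note carr = H_carrier[OF y0(2)] H_carrier[OF y0(3)]
  have \<tau>c: "\<tau> \<in> carrier G" using y0 carr \<sigma> by (simp add: dc_act_def)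
  have 1: "dc_act G h g \<tau> = dc_act G (h0 \<otimes> h) (g0 \<otimes> g) \<sigma>" if "h \<in> H" "g \<in> H" for h g
    using that carr \<sigma> H_carrier by (simp add: y0(1) dc_act_def m_assoc inv_mult_group)
  have 2: "dc_act G h g \<sigma> = dc_act G (inv h0 \<otimes> h) (inv g0 \<otimes> g) \<tau>" if "h \<in> H" "g \<in> H" for h g
  proof -
    have "h0 \<otimes> (inv h0 \<otimes> h) = h" "g0 \<otimes> (inv g0 \<otimes> g) = g"
      using that carr H_carrier by (simp_all add: m_assoc[symmetric])
    then show ?thesis
      using 1[of "inv h0 \<otimes> h" "inv g0 \<otimes> g"] that H_mult H_inv y0 by simp
  qed
  show ?thesis
    unfolding double_coset_eq_image[OF \<sigma>] double_coset_eq_image[OF \<tau>c]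
  proof (intro Set.set_eqI iffI)
    fix z assume "z \<in> (\<lambda>x. dc_act G (fst x) (snd x) \<tau>) ` (H \<times> H)"
    then obtain h g where hg: "h \<in> H" "g \<in> H" "z = dc_act G h g \<tau>" by auto
    have "(h0 \<otimes> h, g0 \<otimes> g) \<in> H \<times> H" using hg H_mult H_inv y0 by simp
    moreover have "z = dc_act G (h0 \<otimes> h) (g0 \<otimes> g) \<sigma>" using 1[OF hg(1,2)] hg(3) by simp
    ultimately show "z \<in> (\<lambda>x. dc_act G (fst x) (snd x) \<sigma>) ` (H \<times> H)"
      by (intro image_eqI[of _ _ "(h0 \<otimes> h, g0 \<otimes> g)"]) simp_all
  next
    fix z assume "z \<in> (\<lambda>x. dc_act G (fst x) (snd x) \<sigma>) ` (H \<times> H)"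
    then obtain h g where hg: "h \<in> H" "g \<in> H" "z = dc_act G h g \<sigma>" by auto
    have "(inv h0 \<otimes> h, inv g0 \<otimes> g) \<in> H \<times> H" using hg H_mult H_inv y0 by simp
    moreover have "z = dc_act G (inv h0 \<otimes> h) (inv g0 \<otimes> g) \<tau>" using 2[OF hg(1,2)] hg(3) by simp
    ultimately show "z \<in> (\<lambda>x. dc_act G (fst x) (snd x) \<tau>) ` (H \<times> H)"
      by (intro image_eqI[of _ _ "(inv h0 \<otimes> h, inv g0 \<otimes> g)"]) simp_all
  qed
qed

lemma in_double_coset: "\<sigma> \<in> carrier G \<Longrightarrow> \<sigma> \<in> double_coset G H \<sigma>"
  unfolding double_coset_eq_image
  using one_in_H by (intro image_eqI[of _ _ "(\<one>, \<one>)"]) (auto simp: dc_act_def)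

lemma double_coset_sub: "\<sigma> \<in> carrier G \<Longrightarrow> double_coset G H \<sigma> \<subseteq> carrier G"
  unfolding double_coset_eq_image using H_carrier by (auto simp: dc_act_def)

lemma card_double_coset_pos: "\<sigma> \<in> carrier G \<Longrightarrow> 0 < card (double_coset G H \<sigma>)"
  using in_double_coset double_coset_sub finite_carrier card_gt_0_iff finite_subset by (metis empty_iff)

lemma num_double_cosets_pos: "0 < card (double_coset G H ` carrier G)"
  using finite_carrier card_gt_0_iff one_closed by blast

text \<open>Double cosets partition the group, and on each of them the weights 1/size add up to 1,
  so the total is the number of double cosets.\<close>

lemma stationary_sum_one: "(\<Sum>\<sigma>\<in>carrier G. burnside_stationary G H \<sigma>) = 1"
proof -
  let ?D = "double_coset G H"
  have "(\<Sum>\<sigma>\<in>carrier G. 1 / real (card (?D \<sigma>)))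
      = (\<Sum>D\<in>?D ` carrier G. \<Sum>\<sigma>\<in>{\<sigma> \<in> carrier G. ?D \<sigma> = D}. 1 / real (card (?D \<sigma>)))"
    by (rule sum.image_gen[OF finite_carrier])
  also have "\<dots> = (\<Sum>D\<in>?D ` carrier G. 1)"
  proof (rule sum.cong)
    fix D assume "D \<in> ?D ` carrier G"
    then obtain \<tau> where \<tau>: "\<tau> \<in> carrier G" "D = ?D \<tau>" by auto
    have "{\<sigma> \<in> carrier G. ?D \<sigma> = D} = D"
      using \<tau> double_coset_eq in_double_coset double_coset_sub by blast
    moreover have "\<And>\<sigma>. \<sigma> \<in> {\<sigma> \<in> carrier G. ?D \<sigma> = D} \<Longrightarrow> 1 / real (card (?D \<sigma>)) = 1 / real (card D)"
      by auto
    ultimately have "(\<Sum>\<sigma>\<in>{\<sigma> \<in> carrier G. ?D \<sigma> = D}. 1 / real (card (?D \<sigma>))) = (\<Sum>\<sigma>\<in>D. 1 / real (card D))"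
      by (metis (no_types, lifting) sum.cong)
    also have "\<dots> = 1"
      using card_double_coset_pos[OF \<tau>(1)] \<tau>(2) by simp
    finally show "(\<Sum>\<sigma>\<in>{\<sigma> \<in> carrier G. ?D \<sigma> = D}. 1 / real (card (?D \<sigma>))) = 1" .
  qed auto
  finally have "(\<Sum>\<sigma>\<in>carrier G. 1 / real (card (?D \<sigma>))) = real (card (?D ` carrier G))"
    by simp
  then have "(\<Sum>\<sigma>\<in>carrier G. 1 / real (card (?D \<sigma>))) / real (card (?D ` carrier G)) = 1"
    using num_double_cosets_pos by simp
  then show ?thesis
    unfolding burnside_stationary_def by (simp add: sum_divide_distrib mult.commute)
qed

definition stab_weight :: real where
  "stab_weight = (\<Sum>\<sigma>\<in>carrier G. real (card (dc_stab G H \<sigma>)))"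

lemma stab_weight_pos: "0 < stab_weight"
  unfolding stab_weight_def using finite_carrier card_dc_stab_pos
  by (intro sum_pos) auto

lemma stationary_eq:
  assumes "\<sigma> \<in> carrier G"
  shows "burnside_stationary G H \<sigma> = real (card (dc_stab G H \<sigma>)) / stab_weight"
proof -
  \<comment> \<open>By orbit-stabiliser the weights are \<open>C\<close> times the stabiliser sizes;
    since they sum to 1, \<open>C\<close> must be \<open>1 / stab_weight\<close>.\<close>
  define C where "C = 1 / (real (card (double_coset G H ` carrier G)) * real (card H) ^ 2)"
  have eq: "burnside_stationary G H \<sigma> = C * real (card (dc_stab G H \<sigma>))" if "\<sigma> \<in> carrier G" for \<sigma>
  proof -
    have "real (card H) ^ 2 = real (card (double_coset G H \<sigma>)) * real (card (dc_stab G H \<sigma>))"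
      using card_double_coset[OF that] by (metis of_nat_mult of_nat_power)
    then show ?thesis
      unfolding C_def burnside_stationary_def
      using num_double_cosets_pos card_double_coset_pos[OF that] card_dc_stab_pos[OF that]
      by simp
  qed
  have "1 = (\<Sum>\<sigma>\<in>carrier G. C * real (card (dc_stab G H \<sigma>)))"
    using stationary_sum_one by (simp add: eq)
  then have "C * stab_weight = 1"
    unfolding stab_weight_def by (simp add: sum_distrib_left)
  then show ?thesis
    using eq[OF assms] stab_weight_pos by (simp add: field_simps)
qed

lemma stationary_nonneg: "0 \<le> burnside_stationary G H \<sigma>"
  unfolding burnside_stationary_def by simp

text \<open>Detailed balance: the stabiliser size in the weight cancels the prefactor of the kernel,
  and what remains is a sum over the intersection of two stabilisers, symmetric in \<sigma> and
  \<tau>.\<close>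

lemma stationary_invariant:
  assumes "\<tau> \<in> carrier G"
  shows "(\<Sum>\<sigma>\<in>carrier G. burnside_stationary G H \<sigma> * burnside_kernel G H \<sigma> \<tau>) = burnside_stationary G H \<tau>"
proof -
  have rev: "burnside_stationary G H \<sigma> * burnside_kernel G H \<sigma> \<tau>
      = burnside_stationary G H \<tau> * burnside_kernel G H \<tau> \<sigma>" if "\<sigma> \<in> carrier G" for \<sigma>
    using that assms card_dc_stab_pos[OF that] card_dc_stab_pos[OF assms]
    by (simp add: stationary_eq burnside_kernel_def Int_commute)
  have "(\<Sum>\<sigma>\<in>carrier G. burnside_stationary G H \<sigma> * burnside_kernel G H \<sigma> \<tau>)
      = (\<Sum>\<sigma>\<in>carrier G. burnside_stationary G H \<tau> * burnside_kernel G H \<tau> \<sigma>)"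
    by (rule sum.cong) (simp_all add: rev)
  then show ?thesis
    using kernel_sum_one[OF assms] by (simp add: sum_distrib_left[symmetric])
qed

text \<open>The defining recursion adds a step at the end; this one splits off the first step, as
  inductions over all starting states require.\<close>

lemma dist_Suc:
  assumes "\<sigma> \<in> carrier G" "\<tau> \<in> carrier G"
  shows "burnside_dist G H (Suc t) \<sigma> \<tau>
    = (\<Sum>\<rho>\<in>carrier G. burnside_kernel G H \<sigma> \<rho> * burnside_dist G H t \<rho> \<tau>)"
  using assms(2)
proof (induction t arbitrary: \<tau>)
  case 0
  have "(\<Sum>\<rho>\<in>carrier G. (if \<rho> = \<sigma> then 1 else 0) * burnside_kernel G H \<rho> \<tau>) = burnside_kernel G H \<sigma> \<tau>"
    using assms(1) finite_carrier by (simp add: if_distrib[of "\<lambda>x. x * _"] cong: if_cong)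
  moreover have "(\<Sum>\<rho>\<in>carrier G. burnside_kernel G H \<sigma> \<rho> * (if \<tau> = \<rho> then 1 else 0)) = burnside_kernel G H \<sigma> \<tau>"
    using 0 finite_carrier by (simp add: if_distrib[of "\<lambda>x. _ * x"] cong: if_cong)
  ultimately show ?case by simp
next
  case (Suc t)
  have "burnside_dist G H (Suc (Suc t)) \<sigma> \<tau>
      = (\<Sum>\<rho>\<in>carrier G. (\<Sum>\<rho>'\<in>carrier G. burnside_kernel G H \<sigma> \<rho>' * burnside_dist G H t \<rho>' \<rho>) * burnside_kernel G H \<rho> \<tau>)"
    by (subst burnside_dist.simps(2)) (intro sum.cong, auto simp: Suc.IH simp del: burnside_dist.simps)
  also have "\<dots> = (\<Sum>\<rho>'\<in>carrier G. \<Sum>\<rho>\<in>carrier G. burnside_kernel G H \<sigma> \<rho>' * (burnside_dist G H t \<rho>' \<rho> * burnside_kernel G H \<rho> \<tau>))"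
    unfolding sum_distrib_right by (subst sum.swap) (simp add: mult.assoc)
  also have "\<dots> = (\<Sum>\<rho>'\<in>carrier G. burnside_kernel G H \<sigma> \<rho>' * burnside_dist G H (Suc t) \<rho>' \<tau>)"
    by (simp add: sum_distrib_left)
  finally show ?case .
qed

lemma dist_nonneg: "0 \<le> burnside_dist G H t \<sigma> \<tau>"
  by (induction t arbitrary: \<tau>) (auto intro!: sum_nonneg mult_nonneg_nonneg kernel_nonneg)

lemma dist_sum_one:
  assumes "\<sigma> \<in> carrier G"
  shows "(\<Sum>\<tau>\<in>carrier G. burnside_dist G H t \<sigma> \<tau>) = 1"
proof (induction t)
  case 0
  then show ?case using assms finite_carrier by simp
next
  case (Suc t)
  have "(\<Sum>\<tau>\<in>carrier G. burnside_dist G H (Suc t) \<sigma> \<tau>)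
      = (\<Sum>\<rho>\<in>carrier G. burnside_dist G H t \<sigma> \<rho> * (\<Sum>\<tau>\<in>carrier G. burnside_kernel G H \<rho> \<tau>))"
    unfolding burnside_dist.simps sum_distrib_left by (rule sum.swap)
  also have "\<dots> = 1"
    using Suc by (simp add: kernel_sum_one)
  finally show ?case .
qed

section \<open>Total variation distance to stationarity\<close>

definition tv :: "nat \<Rightarrow> 'a \<Rightarrow> real" where
  "tv t \<sigma> = tv_dist (carrier G) (burnside_dist G H t \<sigma>) (burnside_stationary G H)"

text \<open>Conditioning on the first step writes the law as a mixture, and the distance to a fixed
  distribution is convex.\<close>

lemma tv_Suc_le:
  assumes \<sigma>: "\<sigma> \<in> carrier G"
  shows "tv (Suc t) \<sigma> \<le> (\<Sum>\<rho>\<in>carrier G. burnside_kernel G H \<sigma> \<rho> * tv t \<rho>)"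
proof -
  let ?K = "burnside_kernel G H \<sigma>" and ?\<pi> = "burnside_stationary G H"
  have "(\<Sum>\<tau>\<in>carrier G. \<bar>burnside_dist G H (Suc t) \<sigma> \<tau> - ?\<pi> \<tau>\<bar>)
      \<le> (\<Sum>\<tau>\<in>carrier G. \<Sum>\<rho>\<in>carrier G. ?K \<rho> * \<bar>burnside_dist G H t \<rho> \<tau> - ?\<pi> \<tau>\<bar>)"
  proof (rule sum_mono)
    fix \<tau> assume "\<tau> \<in> carrier G"
    have "?\<pi> \<tau> = (\<Sum>\<rho>\<in>carrier G. ?K \<rho> * ?\<pi> \<tau>)"
      using kernel_sum_one[OF \<sigma>] by (simp add: sum_distrib_right[symmetric])
    then have "burnside_dist G H (Suc t) \<sigma> \<tau> - ?\<pi> \<tau> = (\<Sum>\<rho>\<in>carrier G. ?K \<rho> * (burnside_dist G H t \<rho> \<tau> - ?\<pi> \<tau>))"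
      using dist_Suc[OF \<sigma> \<open>\<tau> \<in> carrier G\<close>] by (simp add: right_diff_distrib sum_subtractf del: burnside_dist.simps)
    then have "\<bar>burnside_dist G H (Suc t) \<sigma> \<tau> - ?\<pi> \<tau>\<bar> \<le> (\<Sum>\<rho>\<in>carrier G. \<bar>?K \<rho> * (burnside_dist G H t \<rho> \<tau> - ?\<pi> \<tau>)\<bar>)"
      by simp
    also have "\<dots> = (\<Sum>\<rho>\<in>carrier G. ?K \<rho> * \<bar>burnside_dist G H t \<rho> \<tau> - ?\<pi> \<tau>\<bar>)"
      using kernel_nonneg by (simp add: abs_mult)
    finally show "\<bar>burnside_dist G H (Suc t) \<sigma> \<tau> - ?\<pi> \<tau>\<bar> \<le> (\<Sum>\<rho>\<in>carrier G. ?K \<rho> * \<bar>burnside_dist G H t \<rho> \<tau> - ?\<pi> \<tau>\<bar>)" .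
  qed
  also have "\<dots> = (\<Sum>\<rho>\<in>carrier G. ?K \<rho> * (\<Sum>\<tau>\<in>carrier G. \<bar>burnside_dist G H t \<rho> \<tau> - ?\<pi> \<tau>\<bar>))"
    by (subst sum.swap) (simp add: sum_distrib_left)
  also have "\<dots> = 2 * (\<Sum>\<rho>\<in>carrier G. ?K \<rho> * tv t \<rho>)"
    by (simp add: tv_def tv_dist_def sum_distrib_left mult.left_commute)
  finally show ?thesis
    unfolding tv_def[of "Suc t"] tv_dist_def by simp
qed

text \<open>If \<open>c\<close> times the law lies below the stationary distribution, their
  difference is bounded pointwise by two nonnegative functions, each of total mass
  \<open>1 - c\<close>.\<close>

lemma tv_le_deficit:
  assumes \<sigma>: "\<sigma> \<in> carrier G" and c: "c \<le> 1"
    and lb: "\<And>\<tau>. \<tau> \<in> carrier G \<Longrightarrow> c * burnside_dist G H t \<sigma> \<tau> \<le> burnside_stationary G H \<tau>"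
  shows "tv t \<sigma> \<le> 1 - c"
proof -
  let ?d = "burnside_dist G H t \<sigma>" and ?\<pi> = "burnside_stationary G H"
  have "(\<Sum>\<tau>\<in>carrier G. \<bar>?d \<tau> - ?\<pi> \<tau>\<bar>) \<le> (\<Sum>\<tau>\<in>carrier G. (1 - c) * ?d \<tau> + (?\<pi> \<tau> - c * ?d \<tau>))"
  proof (rule sum_mono)
    fix \<tau> assume "\<tau> \<in> carrier G"
    have "0 \<le> (1 - c) * ?d \<tau>" using c dist_nonneg by simp
    then show "\<bar>?d \<tau> - ?\<pi> \<tau>\<bar> \<le> (1 - c) * ?d \<tau> + (?\<pi> \<tau> - c * ?d \<tau>)"
      using lb[OF \<open>\<tau> \<in> carrier G\<close>] by (simp add: algebra_simps abs_if)
  qed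
  also have "\<dots> = (1 - c) + (1 - c)"
    using dist_sum_one[OF \<sigma>] stationary_sum_one
    by (simp add: sum.distrib sum_subtractf sum_distrib_left[symmetric])
  finally show ?thesis
    unfolding tv_def tv_dist_def by simp
qed

lemma tv_le_one: "\<sigma> \<in> carrier G \<Longrightarrow> tv t \<sigma> \<le> 1"
  using tv_le_deficit[of \<sigma> 0 t] stationary_nonneg by simp

text \<open>Lower bound by a test event: the signed differences sum to zero, so \<open>A\<close> and
  its complement contribute equal amounts of opposite sign.\<close>

lemma tv_ge_diff:
  assumes \<sigma>: "\<sigma> \<in> carrier G" and A: "A \<subseteq> carrier G"
  shows "(\<Sum>\<tau>\<in>A. burnside_stationary G H \<tau>) - (\<Sum>\<tau>\<in>A. burnside_dist G H t \<sigma> \<tau>) \<le> tv t \<sigma>"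
proof -
  let ?e = "\<lambda>\<tau>. burnside_stationary G H \<tau> - burnside_dist G H t \<sigma> \<tau>"
  have fin: "finite A" using A finite_carrier finite_subset by blast
  have split: "sum f (carrier G) = sum f A + sum f (carrier G - A)" for f :: "'a \<Rightarrow> real"
    using A finite_carrier by (simp add: sum.subset_diff)
  have "sum ?e (carrier G) = 0"
    using dist_sum_one[OF \<sigma>] stationary_sum_one by (simp add: sum_subtractf)
  then have "sum ?e (carrier G - A) = - sum ?e A" using split[of ?e] by simp
  then have "2 * sum ?e A = sum ?e A + - sum ?e (carrier G - A)" by simp
  also have "\<dots> \<le> (\<Sum>\<tau>\<in>A. \<bar>?e \<tau>\<bar>) + (\<Sum>\<tau>\<in>carrier G - A. \<bar>?e \<tau>\<bar>)"
    using sum_abs[of ?e A] sum_abs[of ?e "carrier G - A"] by linarith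
  also have "\<dots> = 2 * tv t \<sigma>"
    using split[of "\<lambda>\<tau>. \<bar>?e \<tau>\<bar>"] by (simp add: tv_def tv_dist_def abs_minus_commute)
  finally show ?thesis by (simp add: sum_subtractf)
qed

end

section \<open>Sylow subgroups of symmetric groups\<close>

text \<open>Makes a Sylow subgroup of order at least \<open>p ^ k\<close>; the reverse inequality
  comes later from counting blocks.\<close>

lemma prime_power_dvd_fact:
  fixes p k :: nat
  assumes "p \<ge> 1"
  shows "p ^ k dvd (fact (p * k) :: nat)"
proof (induction k)
  case (Suc k)
  have "fact (p * Suc k) = p * Suc k * (fact (p * Suc k - 1) :: nat)"
    using assms fact_reduce[of "p * Suc k", where 'a = nat] by simp
  moreover have "p ^ k dvd (fact (p * Suc k - 1) :: nat)"
  proof (rule dvd_trans[OF Suc])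
    have "p * k \<le> p * Suc k - 1" using assms by simp
    then show "fact (p * k) dvd (fact (p * Suc k - 1) :: nat)" by (rule fact_dvd)
  qed
  moreover have "p dvd p * Suc k" by simp
  ultimately show ?case by (metis mult_dvd_mono power_Suc)
qed simp

text \<open>\<open>d\<close> is the least period of \<open>x\<close> under \<open>h\<close>. The
  clause for \<open>d = 1\<close> serves to exclude trivial cycles at points that \<open>h\<close>
  moves.\<close>

lemma finite_cycle:
  fixes h :: "'a \<Rightarrow> 'a"
  assumes inj: "inj h" and n: "0 < n" "(h ^^ n) x = x"
  obtains d where "d dvd n" "0 < d" "inj_on (\<lambda>i. (h ^^ i) x) {..<d}" "d = 1 \<Longrightarrow> h x = x"
    "(\<lambda>i. (h ^^ i) x) ` {..<d} = range (\<lambda>i. (h ^^ i) x)"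
proof -
  define d where "d = (LEAST d. 0 < d \<and> (h ^^ d) x = x)"
  have d: "0 < d" "(h ^^ d) x = x"
    using LeastI[of "\<lambda>d. 0 < d \<and> (h ^^ d) x = x" n] n unfolding d_def by auto
  have least: "d \<le> m" if "0 < m" "(h ^^ m) x = x" for m
    unfolding d_def using that by (intro Least_le) auto
  have mult: "(h ^^ (d * q)) x = x" for q
  proof (induction q)
    case (Suc q)
    then show ?case using d by (simp add: funpow_add)
  qed simp
  have mod: "(h ^^ m) x = (h ^^ (m mod d)) x" for m
  proof -
    have "(h ^^ m) x = (h ^^ (m mod d + d * (m div d))) x" by simp
    also have "\<dots> = (h ^^ (m mod d)) x" unfolding funpow_add by (simp add: mult)
    finally show ?thesis .
  qed
  have "n mod d = 0"
  proof (rule ccontr)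
    assume "n mod d \<noteq> 0"
    then have "d \<le> n mod d" using mod[of n] n by (intro least) auto
    then show False using mod_less_divisor[OF d(1), of n] by linarith
  qed
  then have dvd: "d dvd n" by auto
  have inj_d: "inj_on (\<lambda>i. (h ^^ i) x) {..<d}"
  proof (rule linorder_inj_onI')
    fix i j assume ij: "i \<in> {..<d}" "j \<in> {..<d}" "i < j"
    show "(h ^^ i) x \<noteq> (h ^^ j) x"
    proof
      assume eq: "(h ^^ i) x = (h ^^ j) x"
      have "(h ^^ j) x = (h ^^ i) ((h ^^ (j - i)) x)"
        using ij by (metis comp_apply funpow_add le_add_diff_inverse less_imp_le)
      then have "(h ^^ i) ((h ^^ (j - i)) x) = (h ^^ i) x" using eq by simp
      then have "(h ^^ (j - i)) x = x" by (rule injD[OF inj_fn[OF inj]])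
      then have "d \<le> j - i" using ij by (intro least) auto
      then show False using ij by simp
    qed
  qed
  have one: "h x = x" if "d = 1" using d \<open>d = 1\<close> by simp
  have ran: "(\<lambda>i. (h ^^ i) x) ` {..<d} = range (\<lambda>i. (h ^^ i) x)"
  proof (intro subset_antisym subsetI)
    fix y assume "y \<in> range (\<lambda>i. (h ^^ i) x)"
    then obtain i where "y = (h ^^ i) x" by auto
    then have "y = (h ^^ (i mod d)) x" using mod[of i] by simp
    then show "y \<in> (\<lambda>i. (h ^^ i) x) ` {..<d}" using d(1) by auto
  qed auto
  show thesis by (rule that[OF dvd d(1) inj_d one ran])
qed

locale sylow_sym =
  fixes p k :: nat and H :: "(nat \<Rightarrow> nat) set"
  assumes p_prime: "Factorial_Ring.prime p"
    and k_pos: "1 \<le> k" and k_less: "k < p"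
    and sylow: "sylow_subgroup p (sym_group (p * k)) H"

sublocale sylow_sym \<subseteq> burnside_process "sym_group (p * k)" H
proof -
  have "finite (carrier (sym_group (p * k)))"
    unfolding sym_group_def by (simp add: finite_permutations)
  then show "burnside_process (sym_group (p * k)) H"
    using sylow sym_group_is_group
    unfolding burnside_process_def burnside_process_axioms_def sylow_subgroup_def by blast
qed

context sylow_sym
begin

abbreviation "GS \<equiv> sym_group (p * k)"

lemma p_gt_1: "1 < p"
  using p_prime by (rule prime_gt_1_nat)

lemma H_permutes: "h \<in> H \<Longrightarrow> h permutes {1..p*k}"
  using H_carrier by (simp add: sym_group_carrier)

lemma H_comp: "h \<in> H \<Longrightarrow> g \<in> H \<Longrightarrow> h \<circ> g \<in> H"
  using H_mult by (simp add: sym_group_mult)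

lemma H_id: "id \<in> H"
  using one_in_H by (simp add: sym_group_one)

lemma H_inverse: "h \<in> H \<Longrightarrow> inv' h \<in> H"
  using H_inv[of h] H_carrier[of h] by simp

lemma H_funpow: "h \<in> H \<Longrightarrow> h ^^ i \<in> H"
  by (induction i) (use H_id H_comp in auto)

lemma H_inj: "h \<in> H \<Longrightarrow> inj h"
  using H_permutes permutes_inj by blast

lemma card_H: obtains N where "card H = p ^ N" "k \<le> N"
proof
  let ?N = "multiplicity p (order GS)"
  show "card H = p ^ ?N" using sylow by (simp add: sylow_subgroup_def)
  have "order GS = fact (p * k)"
    unfolding order_def sym_group_def by (simp add: card_permutations)
  then show "k \<le> ?N"
    using prime_power_dvd_fact[of p k] p_gt_1 by (simp add: multiplicity_geI)
qed

text \<open>Lagrange's theorem inside \<open>H\<close>; it forces every cycle of an element of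
  \<open>H\<close> to have \<open>p\<close>-power length.\<close>

lemma funpow_card_H: 
  assumes "h \<in> H"
  shows "h ^^ card H = id"
proof -
  let ?S = "sym_group (p * k)\<lparr>carrier := H\<rparr>"
  interpret S: group ?S
    using subgroup.subgroup_is_group[OF subgroup_H is_group] .
  have "h [^]\<^bsub>?S\<^esub> n = h ^^ n" for n :: nat
    by (induction n) (simp_all add: sym_group_one sym_group_mult funpow_swap1 fun_eq_iff)
  then show ?thesis
    using S.pow_order_eq_1[of h] assms by (simp add: order_def sym_group_one)
qed

section \<open>Orbits of the Sylow subgroup on points\<close>

definition orb :: "nat \<Rightarrow> nat set" where
  "orb x = (\<lambda>h. h x) ` H"

lemma orb_memI: "h \<in> H \<Longrightarrow> h x \<in> orb x"
  by (simp add: orb_def)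

lemma orb_self: "x \<in> orb x"
  using orb_memI[OF H_id, of x] by simp

lemma finite_orb: "finite (orb x)"
  unfolding orb_def using finite_H by simp

lemma orb_eq: 
  assumes "y \<in> orb x"
  shows "orb y = orb x"
proof -
  have sub: "orb y \<subseteq> orb x" if y: "y \<in> orb x" for x y
  proof
    fix z assume "z \<in> orb y"
    then obtain h g where "h \<in> H" "g \<in> H" "z = h y" "y = g x"
      using y by (auto simp: orb_def)
    then show "z \<in> orb x" using orb_memI[OF H_comp, of h g x] by simp
  qed
  obtain h where h: "h \<in> H" "y = h x" using assms by (auto simp: orb_def)
  then have "inv' h y = x" using H_inj by (simp add: inv_f_f)
  then have "x \<in> orb y" using orb_memI[OF H_inverse[OF h(1)], of y] by simp
  then show ?thesis using sub assms by blast
qed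

lemma orb_sub: "x \<in> {1..p*k} \<Longrightarrow> orb x \<subseteq> {1..p*k}"
  unfolding orb_def using permutes_in_image[OF H_permutes] by auto

text \<open>Orbit-stabiliser again: the fibres of evaluation at \<open>x\<close> are left translates
  of the point stabiliser.\<close>

lemma card_orb_dvd: "card (orb x) dvd card H"
proof -
  let ?st = "{h \<in> H. h x = x}"
  have fib: "card {h \<in> H. h x = y} = card ?st" if y: "y \<in> orb x" for y
  proof -
    obtain g where g: "g \<in> H" "y = g x" using y by (auto simp: orb_def)
    have "bij_betw (\<lambda>h. g \<circ> h) ?st {h \<in> H. h x = y}"
    proof (rule bij_betwI[where g = "\<lambda>h. inv' g \<circ> h"])
      show "(\<lambda>h. g \<circ> h) \<in> ?st \<rightarrow> {h \<in> H. h x = y}"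
        using g H_comp by auto
      show "(\<lambda>h. inv' g \<circ> h) \<in> {h \<in> H. h x = y} \<rightarrow> ?st"
        using g H_comp[OF H_inverse] H_inj by auto
    qed (auto simp: permutes_inverses[OF H_permutes[OF g(1)]] fun_eq_iff)
    then show ?thesis by (simp add: bij_betw_same_card)
  qed
  have "card H = (\<Sum>y\<in>orb x. \<Sum>h\<in>{h \<in> H. h x = y}. 1)"
    unfolding orb_def using finite_H by (subst sum.image_gen[symmetric]) auto
  also have "\<dots> = (\<Sum>y\<in>orb x. card ?st)"
    by (rule sum.cong) (use fib in auto)
  finally show ?thesis by simp
qed

text \<open>The size is a power of \<open>p\<close>, and \<open>k < p\<close> keeps it below
  \<open>p ^ 2\<close>.\<close>

lemma card_orb_cases:
  assumes "x \<in> {1..p*k}"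
  shows "card (orb x) = 1 \<or> card (orb x) = p"
proof -
  obtain N where "card H = p ^ N" using card_H by blast
  then obtain e where e: "card (orb x) = p ^ e"
    using card_orb_dvd[of x] p_prime by (auto simp: divides_primepow_nat)
  have "card (orb x) \<le> card {1..p*k}"
    using orb_sub[OF assms] by (intro card_mono) auto
  also have "\<dots> < p ^ 2"
    using k_less p_gt_1 by (simp add: power2_eq_square)
  finally have "p ^ e < p ^ 2" unfolding e .
  then have "e < 2" by (rule power_less_imp_less_exp[OF p_gt_1])
  then show ?thesis using e by (auto simp: less_2_cases_iff)
qed

lemma moved_in_range:
  assumes "h \<in> H" "h x \<noteq> x"
  shows "x \<in> {1..p*k}"
  using permutes_not_in[OF H_permutes[OF assms(1)], of x] assms(2) by auto

lemma card_orb_moved: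
  assumes "h \<in> H" "h x \<noteq> x"
  shows "card (orb x) = p"
proof -
  have "{x, h x} \<subseteq> orb x" using orb_self orb_memI assms by auto
  then have "card {x, h x} \<le> card (orb x)" by (intro card_mono finite_orb)
  then show ?thesis using card_orb_cases[OF moved_in_range[OF assms]] assms by auto
qed

text \<open>The cycle of a moved point has \<open>p\<close>-power length other than 1, hence at
  least \<open>p\<close> points, which is all that the orbit has. A single element of
  \<open>H\<close> thus traces out the whole orbit.\<close>

lemma orb_cycle:
  assumes h: "h \<in> H" "h x \<noteq> x"
  shows "orb x = range (\<lambda>i. (h ^^ i) x)"
proof -
  obtain N where N: "card H = p ^ N" using card_H by blast
  have "(h ^^ p ^ N) x = x" using funpow_card_H[OF h(1)] N by simp
  then obtain d where d: "d dvd p ^ N" "0 < d" "inj_on (\<lambda>i. (h ^^ i) x) {..<d}" "d = 1 \<Longrightarrow> h x = x"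
    "(\<lambda>i. (h ^^ i) x) ` {..<d} = range (\<lambda>i. (h ^^ i) x)"
    using finite_cycle[OF H_inj[OF h(1)], of "p ^ N" x] p_gt_1 by (metis gr0I less_numeral_extra(3) not_one_less_zero power_eq_0_iff zero_less_iff_neq_zero)
  have sub: "range (\<lambda>i. (h ^^ i) x) \<subseteq> orb x"
    using orb_memI[OF H_funpow[OF h(1)]] by auto
  have cardd: "card (range (\<lambda>i. (h ^^ i) x)) = d"
    using card_image[OF d(3)] d(5) by simp
  obtain e where e: "d = p ^ e" using d(1) p_prime by (auto simp: divides_primepow_nat)
  have "d \<noteq> 1" using d(4) h(2) by auto
  then have "p \<le> d" using e p_gt_1 by (cases e) auto
  then have "card (orb x) \<le> card (range (\<lambda>i. (h ^^ i) x))"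
    using card_orb_moved[OF h] cardd by simp
  then show ?thesis
    using card_seteq[OF finite_orb sub] by simp
qed

text \<open>An element fixing a point of an orbit would otherwise act on it as a \<open>p\<close>-cycle.\<close>

lemma fixes_orb:
  assumes u: "u \<in> H" "u x = x" and y: "y \<in> orb x"
  shows "u y = y"
proof (rule ccontr)
  assume ne: "u y \<noteq> y"
  have "x \<in> orb y" using orb_eq[OF y] orb_self by simp
  then obtain i where i: "x = (u ^^ i) y" using orb_cycle[OF u(1) ne] by auto
  have "(u ^^ i) (u y) = u ((u ^^ i) y)" by (simp add: funpow_swap1)
  also have "\<dots> = (u ^^ i) y" using i u by simp
  finally have "u y = y" by (rule injD[OF inj_fn[OF H_inj[OF u(1)]]])
  then show False using ne by simp
qed

text \<open>\<open>inv' g \<circ> h\<close> fixes \<open>x\<close>, hence the whole orbit. So one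
  value determines an element of \<open>H\<close> on an orbit.\<close>

lemma agree_on_orb:
  assumes h: "h \<in> H" and g: "g \<in> H" and eq: "h x = g x" and y: "y \<in> orb x"
  shows "h y = g y"
proof -
  have "(inv' g \<circ> h) y = y"
    using fixes_orb[of "inv' g \<circ> h" x y] H_comp[OF H_inverse[OF g] h] H_inj[OF g] eq y by simp
  then have "g (inv' g (h y)) = g y" by simp
  then show ?thesis using permutes_inverses(1)[OF H_permutes[OF g]] by simp
qed

section \<open>Blocks, and the Sylow subgroup as the full product over them\<close>

definition Blocks :: "nat set set" where
  "Blocks = {B \<in> orb ` {1..p*k}. card B = p}"

text \<open>An arbitrary base point: by \<open>agree_on_orb\<close>, the value there determines an
  element of \<open>H\<close> on the block.\<close>

definition pt :: "nat set \<Rightarrow> nat" where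
  "pt B = (SOME x. x \<in> B)"

lemma Blocks_orb: 
  assumes "B \<in> Blocks" "x \<in> B"
  shows "orb x = B"
  using assms orb_eq by (auto simp: Blocks_def)

lemma orb_in_Blocks:
  assumes "h \<in> H" "h x \<noteq> x"
  shows "orb x \<in> Blocks"
  using moved_in_range[OF assms] card_orb_moved[OF assms] by (auto simp: Blocks_def)

lemma Blocks_sub: "B \<in> Blocks \<Longrightarrow> B \<subseteq> {1..p*k}"
  unfolding Blocks_def using orb_sub by blast

lemma card_Block: "B \<in> Blocks \<Longrightarrow> card B = p"
  by (simp add: Blocks_def)

lemma finite_Block: "B \<in> Blocks \<Longrightarrow> finite B"
  using Blocks_sub finite_subset by blast

lemma finite_Blocks: "finite Blocks"
  unfolding Blocks_def by simp

lemma pt_in: "B \<in> Blocks \<Longrightarrow> pt B \<in> B"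
  unfolding pt_def using card_Block p_gt_1 by (metis card.empty ex_in_conv not_one_less_zero someI)

lemma orb_pt: "B \<in> Blocks \<Longrightarrow> orb (pt B) = B"
  using Blocks_orb pt_in by blast

lemma Blocks_disjoint: "B \<in> Blocks \<Longrightarrow> C \<in> Blocks \<Longrightarrow> x \<in> B \<Longrightarrow> x \<in> C \<Longrightarrow> B = C"
  using Blocks_orb by blast

lemma moves_pt_iff:
  assumes "h \<in> H" "B \<in> Blocks" "x \<in> B"
  shows "h x = x \<longleftrightarrow> h (pt B) = pt B"
  using assms fixes_orb Blocks_orb pt_in by metis

lemma card_Blocks_le: "card Blocks \<le> k"
proof -
  have "p * card Blocks = card (\<Union>Blocks)"
    using Blocks_disjoint card_Block finite_Block finite_Blocks
    by (subst card_partition[symmetric, where k = p]) auto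
  also have "\<dots> \<le> card {1..p*k}"
    using Blocks_sub by (intro card_mono) auto
  finally show ?thesis using p_gt_1 by simp
qed

lemma H_eqI:
  assumes "h \<in> H" "g \<in> H" and eq: "\<And>B. B \<in> Blocks \<Longrightarrow> h (pt B) = g (pt B)"
  shows "h = g"
proof
  fix x
  show "h x = g x"
  proof (cases "orb x \<in> Blocks")
    case True
    then show ?thesis
      using agree_on_orb[OF assms(1,2) eq[OF True], of x] orb_pt[OF True] orb_self by simp
  next
    case False
    then show ?thesis using orb_in_Blocks assms(1,2) by metis
  qed
qed

lemma eval_in_PiE:
  assumes "h \<in> H" "J \<subseteq> Blocks"
  shows "(\<lambda>B\<in>J. h (pt B)) \<in> (\<Pi>\<^sub>E B\<in>J. B)"
  using assms orb_memI[OF assms(1)] orb_pt by (auto simp: subset_iff)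

lemma card_PiE_blocks: "J \<subseteq> Blocks \<Longrightarrow> card (\<Pi>\<^sub>E B\<in>J. B) = p ^ card J"
  using card_Block finite_subset[OF _ finite_Blocks] by (subst card_PiE) (auto simp: subset_iff)

text \<open>Evaluation at base points is injective, so p^k \<le> |H| \<le> p^|Blocks| \<le> p^k.
  Equality throughout gives the number of blocks and makes evaluation surjective.\<close>

lemma card_Blocks: "card Blocks = k"
  and eval_bij: "bij_betw (\<lambda>h. \<lambda>B\<in>Blocks. h (pt B)) H (\<Pi>\<^sub>E B\<in>Blocks. B)"
proof -
  let ?ev = "\<lambda>h. \<lambda>B\<in>Blocks. h (pt B)" and ?P = "\<Pi>\<^sub>E B\<in>Blocks. B"
  obtain N where N: "card H = p ^ N" "k \<le> N" using card_H by blast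
  have inj: "inj_on ?ev H"
  proof (rule inj_onI)
    fix h g assume hg: "h \<in> H" "g \<in> H" "?ev h = ?ev g"
    then have "h (pt B) = g (pt B)" if "B \<in> Blocks" for B
      using that by (metis restrict_apply')
    then show "h = g" using H_eqI hg by blast
  qed
  have sub: "?ev ` H \<subseteq> ?P" using eval_in_PiE by blast
  have fin: "finite ?P" using finite_Blocks finite_Block by (intro finite_PiE) auto
  have "p ^ N \<le> p ^ card Blocks"
    using card_mono[OF fin sub] card_image[OF inj] card_PiE_blocks N by simp
  then have "N \<le> card Blocks" using p_gt_1 by simp
  then show k: "card Blocks = k" using N card_Blocks_le by simp
  have "card ?P \<le> card (?ev ` H)"
    using k \<open>N \<le> card Blocks\<close> N card_image[OF inj] card_PiE_blocks by simp
  then show "bij_betw ?ev H ?P"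
    using card_seteq[OF fin sub] inj by (simp add: bij_betw_def)
qed

definition restr :: "(nat \<Rightarrow> nat) \<Rightarrow> nat set \<Rightarrow> nat \<Rightarrow> nat" where
  "restr h B x = (if x \<in> B then h x else x)"

text \<open>Surjectivity of evaluation supplies an element of \<open>H\<close> that acts like
  \<open>h\<close> at the base point of \<open>B\<close> and fixes the other base points. Agreement
  on orbits identifies it with the restriction.\<close>

lemma restr_in_H:
  assumes h: "h \<in> H" and B: "B \<in> Blocks"
  shows "restr h B \<in> H"
proof -
  define f where "f = (\<lambda>C\<in>Blocks. if C = B then h (pt C) else pt C)"
  have "h (pt B) \<in> B" using orb_memI[OF h] orb_pt[OF B] by metis
  then have "f \<in> (\<Pi>\<^sub>E B\<in>Blocks. B)"
    unfolding f_def using pt_in by auto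
  then have "f \<in> (\<lambda>h. \<lambda>B\<in>Blocks. h (pt B)) ` H"
    using bij_betw_imp_surj_on[OF eval_bij] by simp
  then obtain g where g: "f = (\<lambda>B\<in>Blocks. g (pt B))" "g \<in> H"
    by (rule imageE)
  have val: "g (pt C) = (if C = B then h (pt C) else pt C)" if "C \<in> Blocks" for C
    using fun_cong[OF g(1)[symmetric], of C] that by (simp add: f_def)
  have "restr h B x = g x" for x
  proof (cases "orb x \<in> Blocks")
    case True
    have x: "x \<in> orb x" by (rule orb_self)
    show ?thesis
    proof (cases "orb x = B")
      case eq: True
      then have "h x = g x"
        using agree_on_orb[OF h g(2), of "pt B" x] val[OF B] orb_pt[OF B] x by simp
      then show ?thesis using eq x by (simp add: restr_def)
    next
      case ne: False
      then have "g x = x" using val[OF True] moves_pt_iff[OF g(2) True x] by simp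
      moreover have "x \<notin> B" using ne B Blocks_orb by blast
      ultimately show ?thesis by (simp add: restr_def)
    qed
  next
    case False
    then have "g x = x" "x \<notin> B" using orb_in_Blocks[OF g(2)] Blocks_orb B by blast+
    then show ?thesis by (simp add: restr_def)
  qed
  then have "restr h B = g" by auto
  then show ?thesis using g by simp
qed

subsection \<open>Stabilisers and matched blocks\<close>

definition moved_blocks :: "(nat \<Rightarrow> nat) \<Rightarrow> nat set set" where
  "moved_blocks h = {B \<in> Blocks. h (pt B) \<noteq> pt B}"

text \<open>First coordinates suffice, because \<open>snd x\<close> is the conjugate of
  \<open>fst x\<close> by \<sigma>. The number of these blocks is the j(\<sigma>) of the
  overview.\<close>

definition matched :: "(nat \<Rightarrow> nat) \<Rightarrow> nat set set" where
  "matched \<sigma> = (\<Union>x \<in> dc_stab GS H \<sigma>. moved_blocks (fst x))"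

lemma matched_sub: "matched \<sigma> \<subseteq> Blocks"
  by (auto simp: matched_def moved_blocks_def)

lemma finite_matched: "finite (matched \<sigma>)"
  using matched_sub finite_Blocks finite_subset by blast

lemma card_matched_le: "card (matched \<sigma>) \<le> k"
  using card_mono[OF finite_Blocks matched_sub] card_Blocks by simp

lemma stab_iff:
  assumes "\<sigma> permutes {1..p*k}"
  shows "x \<in> dc_stab GS H \<sigma> \<longleftrightarrow> fst x \<in> H \<and> snd x \<in> H \<and> \<sigma> \<circ> snd x = fst x \<circ> \<sigma>"
  using assms dc_stab_iff[of \<sigma> x] by (simp add: sym_group_carrier sym_group_mult)

lemma fix_iff:
  assumes "h \<in> H" "g \<in> H"
  shows "\<sigma> \<in> dc_fix GS h g \<longleftrightarrow> \<sigma> permutes {1..p*k} \<and> \<sigma> \<circ> g = h \<circ> \<sigma>"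
  using dc_fix_iff[OF assms, of \<sigma>] by (simp add: sym_group_carrier sym_group_mult)

lemma intertwine_funpow:
  assumes "\<sigma> \<circ> g = h \<circ> \<sigma>"
  shows "\<sigma> ((g ^^ i) z) = (h ^^ i) (\<sigma> z)"
  by (induction i) (use assms in \<open>auto simp: fun_eq_iff\<close>)

text \<open>By \<open>orb_cycle\<close> both orbits are cycles, of \<open>g\<close> and of
  \<open>h\<close>, and the intertwining relation sends powers of \<open>g\<close> at
  \<open>y\<close> to powers of \<open>h\<close> at \<open>\<sigma> y\<close>.\<close>

lemma intertwine_orb:
  assumes \<sigma>: "\<sigma> permutes {1..p*k}" and h: "h \<in> H" and g: "g \<in> H"
    and eq: "\<sigma> \<circ> g = h \<circ> \<sigma>" and ne: "h (\<sigma> y) \<noteq> \<sigma> y"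
  shows "g y \<noteq> y" "\<sigma> ` orb y = orb (\<sigma> y)"
proof -
  show ne': "g y \<noteq> y" using ne fun_cong[OF eq, of y] by auto
  show "\<sigma> ` orb y = orb (\<sigma> y)"
    unfolding orb_cycle[OF g ne'] orb_cycle[OF h ne] by (simp add: image_image intertwine_funpow[OF eq])
qed

lemma stab_compose:
  assumes \<sigma>: "\<sigma> permutes {1..p*k}"
    and "x \<in> dc_stab GS H \<sigma>" "y \<in> dc_stab GS H \<sigma>"
  shows "(fst x \<circ> fst y, snd x \<circ> snd y) \<in> dc_stab GS H \<sigma>"
  using assms(2,3) H_comp unfolding stab_iff[OF \<sigma>] by (auto simp: fun_eq_iff)

lemma stab_funpow:
  assumes \<sigma>: "\<sigma> permutes {1..p*k}" and x: "x \<in> dc_stab GS H \<sigma>"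
  shows "(fst x ^^ i, snd x ^^ i) \<in> dc_stab GS H \<sigma>"
  using x H_funpow intertwine_funpow[of \<sigma> "snd x" "fst x" i] unfolding stab_iff[OF \<sigma>]
  by (auto simp: fun_eq_iff)

text \<open>Conjugation by \<open>\<sigma>\<close> carries a \<open>p\<close>-cycle of \<open>g\<close> to a \<open>p\<close>-cycle of \<open>h\<close>, and a \<open>p\<close>-cycle
  of an element of \<open>H\<close> fills a whole orbit of \<open>H\<close>.\<close>

lemma stab_restr:
  assumes \<sigma>: "\<sigma> permutes {1..p*k}" and x: "x \<in> dc_stab GS H \<sigma>"
    and B: "B \<in> moved_blocks (fst x)"
  obtains g where "(restr (fst x) B, g) \<in> dc_stab GS H \<sigma>"
proof -
  have h: "fst x \<in> H" and g: "snd x \<in> H" and eq: "\<sigma> \<circ> snd x = fst x \<circ> \<sigma>"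
    using x stab_iff[OF \<sigma>] by auto
  have B': "B \<in> Blocks" "fst x (pt B) \<noteq> pt B" using B by (auto simp: moved_blocks_def)
  obtain y where y: "\<sigma> y = pt B" using permutes_surj[OF \<sigma>] by (metis surjD)
  have ne: "fst x (\<sigma> y) \<noteq> \<sigma> y" using B' y by simp
  note int = intertwine_orb[OF \<sigma> h g eq ne]
  have im: "\<sigma> ` orb y = B" using int(2) y orb_pt[OF B'(1)] by simp
  have mem: "\<sigma> z \<in> B \<longleftrightarrow> z \<in> orb y" for z
    using inj_image_mem_iff[OF permutes_inj[OF \<sigma>], of z "orb y"] im by simp
  have "restr (snd x) (orb y) \<in> H"
    using restr_in_H[OF g orb_in_Blocks[OF g int(1)]] .
  moreover have "\<sigma> \<circ> restr (snd x) (orb y) = restr (fst x) B \<circ> \<sigma>"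
    using eq mem by (auto simp: restr_def fun_eq_iff)
  ultimately show thesis
    using that restr_in_H[OF h B'(1)] stab_iff[OF \<sigma>] by auto
qed

text \<open>The factors of the stabiliser: a stabilising pair that moves \<open>B\<close> has a
  power taking the base point to \<open>y\<close>, and that power can be cut down to
  \<open>B\<close>.\<close>

lemma stab_single:
  assumes \<sigma>: "\<sigma> permutes {1..p*k}" and B: "B \<in> matched \<sigma>" and y: "y \<in> B"
  obtains c c' where "(c, c') \<in> dc_stab GS H \<sigma>" "c (pt B) = y" "\<And>z. z \<notin> B \<Longrightarrow> c z = z"
\<comment> \<open>Cutting down requires a power that moves \<open>B\<close>, so the base point
  itself is treated separately, by the identity pair.\<close>
proof (cases "y = pt B")
  case True
  have "(id, id) \<in> dc_stab GS H \<sigma>" using stab_iff[OF \<sigma>] H_id by simp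
  then show thesis using that True by auto
next
  case False
  have B': "B \<in> Blocks" using B matched_sub by blast
  obtain x where x: "x \<in> dc_stab GS H \<sigma>" "B \<in> moved_blocks (fst x)"
    using B by (auto simp: matched_def)
  have h: "fst x \<in> H" using x(1) stab_iff[OF \<sigma>] by auto
  have "fst x (pt B) \<noteq> pt B" using x(2) by (auto simp: moved_blocks_def)
  then obtain i where i: "y = (fst x ^^ i) (pt B)"
    using orb_cycle[OF h, of "pt B"] y orb_pt[OF B'] by auto
  have "B \<in> moved_blocks (fst (fst x ^^ i, snd x ^^ i))"
    using i False B' by (auto simp: moved_blocks_def)
  from stab_restr[OF \<sigma> stab_funpow[OF \<sigma> x(1)] this]
  obtain g where "(restr (fst x ^^ i) B, g) \<in> dc_stab GS H \<sigma>" by auto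
  then show thesis
    using that i pt_in[OF B'] by (auto simp: restr_def)
qed

text \<open>The stabiliser is a product of one factor per matched block. Injectivity: unmatched
  blocks are fixed, and the second coordinate is determined by the first. Surjectivity: compose
  elements that act on a single block.\<close>

lemma stab_eval_bij:
  assumes \<sigma>: "\<sigma> permutes {1..p*k}"
  shows "bij_betw (\<lambda>x. \<lambda>B\<in>matched \<sigma>. fst x (pt B)) (dc_stab GS H \<sigma>) (\<Pi>\<^sub>E B\<in>matched \<sigma>. B)"
proof (rule bij_betw_imageI)
  let ?S = "dc_stab GS H \<sigma>"
  let ?ev = "\<lambda>x. \<lambda>B\<in>matched \<sigma>. fst x (pt B)"
  show "inj_on ?ev ?S"
  proof (rule inj_onI)
    fix x y assume x: "x \<in> ?S" and y: "y \<in> ?S" and eq: "?ev x = ?ev y"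
    have H: "fst x \<in> H" "fst y \<in> H" "\<sigma> \<circ> snd x = fst x \<circ> \<sigma>" "\<sigma> \<circ> snd y = fst y \<circ> \<sigma>"
      using x y stab_iff[OF \<sigma>] by auto
    have "fst x (pt B) = fst y (pt B)" if "B \<in> Blocks" for B
    proof (cases "B \<in> matched \<sigma>")
      case True
      then show ?thesis using fun_cong[OF eq, of B] by simp
    next
      case False
      then have "B \<notin> moved_blocks (fst x)" "B \<notin> moved_blocks (fst y)"
        using x y by (auto simp: matched_def)
      then show ?thesis using that by (simp add: moved_blocks_def)
    qed
    then have fst: "fst x = fst y" using H_eqI[OF H(1,2)] by blast
    then have "\<sigma> \<circ> snd x = \<sigma> \<circ> snd y" using H by simp
    then have "snd x = snd y" using permutes_inj[OF \<sigma>] by (simp add: fun_eq_iff inj_eq)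
    then show "x = y" using fst by (simp add: prod_eq_iff)
  qed
  \<comment> \<open>Generalised to subsets \<open>J\<close>, with base points fixed outside
    \<open>J\<close>, so that blocks can be adjoined one at a time.\<close>
  have surj: "\<exists>x\<in>?S. \<forall>B\<in>Blocks. fst x (pt B) = (if B \<in> J then f B else pt B)"
    if "finite J" "J \<subseteq> matched \<sigma>" "\<forall>B\<in>J. f B \<in> B" for J f
    using that
  proof (induction J)
    case empty
    have "(id, id) \<in> ?S" using stab_iff[OF \<sigma>] H_id by simp
    then show ?case by (intro bexI[of _ "(id, id)"]) auto
  next
    case (insert C J)
    then obtain x where x: "x \<in> ?S" "\<forall>B\<in>Blocks. fst x (pt B) = (if B \<in> J then f B else pt B)" by auto
    have C: "C \<in> matched \<sigma>" "f C \<in> C" using insert by auto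
    obtain c c' where c: "(c, c') \<in> ?S" "c (pt C) = f C" "\<And>z. z \<notin> C \<Longrightarrow> c z = z"
      using stab_single[OF \<sigma> C] by metis
    have "C \<in> Blocks" using C matched_sub by blast
    have val: "(c \<circ> fst x) (pt B) = (if B \<in> insert C J then f B else pt B)" if B: "B \<in> Blocks" for B
    proof (cases "B = C")
      case True
      then show ?thesis using x(2) B insert.hyps(2) c(2) by simp
    next
      case False
      \<comment> \<open>The element built so far keeps \<open>pt B\<close> inside \<open>B\<close>,
        out of reach of \<open>c\<close>, which acts on \<open>C\<close> only.\<close>
      have "fst x (pt B) \<in> B" using x(2) B insert.prems pt_in[OF B] by auto
      then have "fst x (pt B) \<notin> C" using False B \<open>C \<in> Blocks\<close> Blocks_disjoint by blast
      then show ?thesis using c(3) False x(2) B by simp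
    qed
    show ?case
      using stab_compose[OF \<sigma> c(1) x(1)] val by (intro bexI[of _ "(c \<circ> fst x, c' \<circ> snd x)"]) auto
  qed
  show "?ev ` ?S = (\<Pi>\<^sub>E B\<in>matched \<sigma>. B)"
  proof (intro subset_antisym subsetI)
    fix f assume f: "f \<in> (\<Pi>\<^sub>E B\<in>matched \<sigma>. B)"
    then have "\<forall>B\<in>matched \<sigma>. f B \<in> B" by auto
    from surj[OF finite_matched subset_refl this]
    obtain x where x: "x \<in> ?S" "\<forall>B\<in>Blocks. fst x (pt B) = (if B \<in> matched \<sigma> then f B else pt B)" by auto
    have "?ev x = f"
    proof
      fix B show "?ev x B = f B"
        using x(2) subsetD[OF matched_sub, of B \<sigma>] PiE_arb[OF f, of B] by (cases "B \<in> matched \<sigma>") auto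
    qed
    then show "f \<in> ?ev ` ?S" using x(1) by blast
  next
    fix f assume "f \<in> ?ev ` ?S"
    then obtain x where x: "f = ?ev x" "x \<in> ?S" by (rule imageE)
    then have "fst x \<in> H" using stab_iff[OF \<sigma>] by blast
    then show "f \<in> (\<Pi>\<^sub>E B\<in>matched \<sigma>. B)"
      unfolding x(1) by (rule eval_in_PiE[OF _ matched_sub])
  qed
qed

text \<open>Generating function of the number of moved blocks. In the product, each matched block
  independently offers one value that leaves it fixed (weight 1) and \<open>p - 1\<close> values
  that move it (weight \<open>y\<close>). At \<open>y = 1\<close> this counts the
  stabiliser.\<close>

lemma sum_stab_power:
  fixes y :: real
  assumes \<sigma>: "\<sigma> permutes {1..p*k}"
  shows "(\<Sum>x\<in>dc_stab GS H \<sigma>. y ^ card (moved_blocks (fst x)))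
    = (1 + (real p - 1) * y) ^ card (matched \<sigma>)"
proof -
  let ?S = "dc_stab GS H \<sigma>"
  let ?J = "matched \<sigma>"
  let ?w = "\<lambda>B b. if b = pt B then 1 else y"
  have "(\<Sum>x\<in>?S. y ^ card (moved_blocks (fst x))) = (\<Sum>x\<in>?S. \<Prod>B\<in>?J. ?w B ((\<lambda>B\<in>?J. fst x (pt B)) B))"
  proof (rule sum.cong)
    fix x assume x: "x \<in> ?S"
    have eq: "moved_blocks (fst x) = {B \<in> ?J. fst x (pt B) \<noteq> pt B}"
      using x matched_sub by (auto simp: matched_def moved_blocks_def)
    have "(\<Prod>B\<in>?J. ?w B ((\<lambda>B\<in>?J. fst x (pt B)) B)) = (\<Prod>B\<in>?J. if fst x (pt B) \<noteq> pt B then y else 1)"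
      by (rule prod.cong) auto
    also have "\<dots> = (\<Prod>B\<in>{B \<in> ?J. fst x (pt B) \<noteq> pt B}. y)"
      by (rule prod.inter_filter[OF finite_matched, symmetric])
    also have "\<dots> = y ^ card (moved_blocks (fst x))"
      by (simp add: eq)
    finally show "y ^ card (moved_blocks (fst x)) = (\<Prod>B\<in>?J. ?w B ((\<lambda>B\<in>?J. fst x (pt B)) B))" by simp
  qed simp
  also have "\<dots> = (\<Sum>f\<in>(\<Pi>\<^sub>E B\<in>?J. B). \<Prod>B\<in>?J. ?w B (f B))"
    by (rule sum.reindex_bij_betw[OF stab_eval_bij[OF \<sigma>]])
  also have "\<dots> = (\<Prod>B\<in>?J. \<Sum>b\<in>B. ?w B b)"
    using finite_matched matched_sub finite_Block by (intro prod_sum_PiE[symmetric]) auto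
  also have "\<dots> = (\<Prod>B\<in>?J. 1 + (real p - 1) * y)"
  proof (rule prod.cong)
    fix B assume "B \<in> ?J"
    then have B: "B \<in> Blocks" using matched_sub by blast
    have "(\<Sum>b\<in>B. ?w B b) = 1 + (\<Sum>b\<in>B - {pt B}. ?w B b)"
      using finite_Block[OF B] pt_in[OF B] by (subst sum.remove) auto
    also have "(\<Sum>b\<in>B - {pt B}. ?w B b) = (\<Sum>b\<in>B - {pt B}. y)" by (rule sum.cong) auto
    also have "\<dots> = (real p - 1) * y"
      using card_Block[OF B] pt_in[OF B] finite_Block[OF B] p_gt_1 by (simp add: card_Diff_singleton of_nat_diff)
    finally show "(\<Sum>b\<in>B. ?w B b) = 1 + (real p - 1) * y" .
  qed simp
  finally show ?thesis by simp
qed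

lemma card_stab:
  assumes \<sigma>: "\<sigma> permutes {1..p*k}"
  shows "card (dc_stab GS H \<sigma>) = p ^ card (matched \<sigma>)"
proof -
  have "real (card (dc_stab GS H \<sigma>)) = real p ^ card (matched \<sigma>)"
    using sum_stab_power[OF \<sigma>, of 1] by simp
  then show ?thesis by (metis of_nat_eq_iff of_nat_power)
qed

text \<open>Differentiate the previous identity at \<open>y = 1\<close>.\<close>

lemma sum_stab_card:
  assumes \<sigma>: "\<sigma> permutes {1..p*k}"
  shows "(\<Sum>x\<in>dc_stab GS H \<sigma>. real (card (moved_blocks (fst x))))
    = (1 - 1 / real p) * real (card (matched \<sigma>)) * real (card (dc_stab GS H \<sigma>))"
proof -
  let ?S = "dc_stab GS H \<sigma>"
  let ?j = "card (matched \<sigma>)"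
  have "((\<lambda>y::real. \<Sum>x\<in>?S. y ^ card (moved_blocks (fst x))) has_real_derivative
      (\<Sum>x\<in>?S. real (card (moved_blocks (fst x))))) (at 1)"
    by (auto intro!: derivative_eq_intros)
  moreover have "((\<lambda>y::real. (1 + (real p - 1) * y) ^ ?j) has_real_derivative
      real ?j * (real p - 1) * real p ^ (?j - 1)) (at 1)"
    by (auto intro!: derivative_eq_intros)
  ultimately have eq: "(\<Sum>x\<in>?S. real (card (moved_blocks (fst x)))) = real ?j * (real p - 1) * real p ^ (?j - 1)"
    using sum_stab_power[OF \<sigma>] by (simp add: DERIV_unique)
  show ?thesis
  \<comment> \<open>For \<open>?j = 0\<close> the exponent \<open>?j - 1\<close> is truncated, but
    the factor \<open>real ?j\<close> vanishes.\<close>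
  proof (cases ?j)
    case (Suc n)
    then show ?thesis
      unfolding eq card_stab[OF \<sigma>] using p_gt_1 by (simp add: field_simps)
  qed (use eq in simp)
qed

subsection \<open>One step of the chain\<close>

text \<open>Bounds the mean number of new matches: fewer than \<open>p\<close> candidate blocks,
  each matched with probability at most \<open>p ^ 3 / fact p\<close>.\<close>

definition err :: real where
  "err = real p ^ 4 / fact p"

lemma err_nonneg: "0 \<le> err"
  by (simp add: err_def)

text \<open>\<open>h\<close> is the identity on \<open>B\<close> and preserves the complement, where
  \<rho> is the identity. Hence composing with \<rho> keeps a permutation in the fixed set of
  \<open>(h, g)\<close>.\<close>

lemma commute_outside:
  assumes h: "h \<in> H" and B: "B \<in> Blocks" "B \<notin> moved_blocks h" and \<rho>: "\<rho> permutes B"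
  shows "h \<circ> \<rho> = \<rho> \<circ> h"
proof
  fix z
  have fixB: "h z = z" if "z \<in> B" for z
    using moves_pt_iff[OF h B(1) that] B by (auto simp: moved_blocks_def)
  show "(h \<circ> \<rho>) z = (\<rho> \<circ> h) z"
  proof (cases "z \<in> B")
    case True
    then have "\<rho> z \<in> B" using permutes_in_image[OF \<rho>] by simp
    then show ?thesis using True fixB by simp
  next
    case False
    have "h z \<notin> B"
      using False Blocks_orb[OF B(1), of "h z"] orb_eq[OF orb_memI[OF h, of z]] orb_self[of z] by auto
    then show ?thesis using False permutes_not_in[OF \<rho>] by simp
  qed
qed

lemma exists_other_point:
  assumes "B \<in> Blocks"
  obtains y where "y \<in> B" "y \<noteq> pt B"
proof -
  have "card (B - {pt B}) \<noteq> 0"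
    using card_Block[OF assms] pt_in[OF assms] p_gt_1 by (simp add: card_Diff_singleton)
  then have "B - {pt B} \<noteq> {}" by force
  then show thesis using that by auto
qed

text \<open>The sets \<open>\<rho> \<circ> A\<close> for the \<open>p!\<close> permutations \<open>\<rho>\<close> of \<open>B\<close> are pairwise disjoint subsets of the
  coset, because the elements of \<open>A\<close> all agree on the orbit of \<open>z\<close>.\<close>

lemma card_prescribed_match:
  fixes z z' y :: nat
  assumes h: "h \<in> H" and g: "g \<in> H" and B: "B \<in> Blocks" "B \<notin> moved_blocks h" and y: "y \<noteq> pt B"
  defines "A \<equiv> {\<tau> \<in> dc_fix GS h g. \<tau> z = pt B \<and> (\<exists>x\<in>dc_stab GS H \<tau>. fst x (pt B) = y \<and> snd x z = z')}"
  shows "fact p * card A \<le> card (dc_fix GS h g)"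
proof -
  let ?R = "{\<rho>. \<rho> permutes B}"
  have agree: "\<tau>1 ` orb z = B \<and> (\<forall>w\<in>orb z. \<tau>1 w = \<tau>2 w)" if m: "\<tau>1 \<in> A" "\<tau>2 \<in> A" for \<tau>1 \<tau>2
  proof -
    have \<tau>: "\<tau>1 permutes {1..p*k}" "\<tau>2 permutes {1..p*k}"
      using m fix_iff[OF h g] by (auto simp: A_def)
    obtain x1 where x1: "x1 \<in> dc_stab GS H \<tau>1" "fst x1 (pt B) = y" "snd x1 z = z'" "\<tau>1 z = pt B"
      using m(1) unfolding A_def by blast
    obtain x2 where x2: "x2 \<in> dc_stab GS H \<tau>2" "fst x2 (pt B) = y" "snd x2 z = z'" "\<tau>2 z = pt B"
      using m(2) unfolding A_def by blast
    note x = x1 x2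
    have H: "fst x1 \<in> H" "snd x1 \<in> H" "fst x2 \<in> H" "snd x2 \<in> H"
      and eq: "\<tau>1 \<circ> snd x1 = fst x1 \<circ> \<tau>1" "\<tau>2 \<circ> snd x2 = fst x2 \<circ> \<tau>2"
      using x1(1) x2(1) stab_iff[OF \<tau>(1)] stab_iff[OF \<tau>(2)] by auto
    have ne: "fst x1 (\<tau>1 z) \<noteq> \<tau>1 z" using x y by simp
    note int = intertwine_orb[OF \<tau>(1) H(1,2) eq(1) ne]
    have pow1: "(fst x1 ^^ i) (pt B) = (fst x2 ^^ i) (pt B)" for i
    proof (induction i)
      case (Suc i)
      have "(fst x1 ^^ i) (pt B) \<in> orb (pt B)" by (rule orb_memI[OF H_funpow[OF H(1)]])
      then have "fst x1 ((fst x1 ^^ i) (pt B)) = fst x2 ((fst x1 ^^ i) (pt B))"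
        using agree_on_orb[OF H(1,3), of "pt B"] x by simp
      then show ?case using Suc by simp
    qed simp
    have pow2: "(snd x1 ^^ i) z = (snd x2 ^^ i) z" for i
    proof (induction i)
      case (Suc i)
      have "(snd x1 ^^ i) z \<in> orb z" by (rule orb_memI[OF H_funpow[OF H(2)]])
      then have "snd x1 ((snd x1 ^^ i) z) = snd x2 ((snd x1 ^^ i) z)"
        using agree_on_orb[OF H(2,4), of z] x by simp
      then show ?case using Suc by simp
    qed simp
    \<comment> \<open>Starting from the common value at \<open>z\<close>, both permutations are
      forced along the cycle of \<open>z\<close>, which is its whole orbit.\<close>
    have "\<tau>1 w = \<tau>2 w" if "w \<in> orb z" for w
    proof -
      obtain i where "w = (snd x1 ^^ i) z" using orb_cycle[OF H(2) int(1)] \<open>w \<in> orb z\<close> by auto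
      then show ?thesis
        using intertwine_funpow[OF eq(1), of i z] intertwine_funpow[OF eq(2), of i z] pow1 pow2 x by simp
    qed
    then show ?thesis using int(2) x orb_pt[OF B(1)] by simp
  qed
  have inj: "inj_on (\<lambda>(\<rho>, \<tau>). \<rho> \<circ> \<tau>) (?R \<times> A)"
  proof (rule inj_onI)
    fix u v assume uv: "u \<in> ?R \<times> A" "v \<in> ?R \<times> A" and eq: "(\<lambda>(\<rho>, \<tau>). \<rho> \<circ> \<tau>) u = (\<lambda>(\<rho>, \<tau>). \<rho> \<circ> \<tau>) v"
    obtain \<rho>1 \<tau>1 \<rho>2 \<tau>2 where e: "u = (\<rho>1, \<tau>1)" "v = (\<rho>2, \<tau>2)" by (cases u, cases v)
    have \<rho>: "\<rho>1 permutes B" "\<rho>2 permutes B" and \<tau>A: "\<tau>1 \<in> A" "\<tau>2 \<in> A" and eq': "\<rho>1 \<circ> \<tau>1 = \<rho>2 \<circ> \<tau>2"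
      using uv eq e by auto
    note ag = agree[OF \<tau>A]
    have "\<rho>1 b = \<rho>2 b" for b
    proof (cases "b \<in> B")
      case True
      then obtain w where "w \<in> orb z" "b = \<tau>1 w" using ag by auto
      then show ?thesis using ag fun_cong[OF eq', of w] by simp
    next
      case False
      then show ?thesis using permutes_not_in[OF \<rho>(1)] permutes_not_in[OF \<rho>(2)] by simp
    qed
    then have "\<rho>1 = \<rho>2" by auto
    then have "\<tau>1 = \<tau>2"
      using eq' permutes_inj[OF \<rho>(2)] by (simp add: fun_eq_iff inj_eq)
    then show "u = v" using e \<open>\<rho>1 = \<rho>2\<close> by simp
  qed
  have sub: "(\<lambda>(\<rho>, \<tau>). \<rho> \<circ> \<tau>) ` (?R \<times> A) \<subseteq> dc_fix GS h g"
  proof (clarify)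
    fix \<rho> \<tau> assume \<rho>: "\<rho> permutes B" and "\<tau> \<in> A"
    then have \<tau>: "\<tau> permutes {1..p*k}" "\<tau> \<circ> g = h \<circ> \<tau>" using fix_iff[OF h g] by (auto simp: A_def)
    have "\<rho> \<circ> \<tau> permutes {1..p*k}"
      using permutes_compose[OF \<tau>(1)] permutes_subset[OF \<rho> Blocks_sub[OF B(1)]] by blast
    moreover have "(\<rho> \<circ> \<tau>) \<circ> g = h \<circ> (\<rho> \<circ> \<tau>)"
      using commute_outside[OF h B \<rho>] \<tau>(2) by (metis comp_assoc)
    ultimately show "\<rho> \<circ> \<tau> \<in> dc_fix GS h g" using fix_iff[OF h g] by blast
  qed
  have "card (?R \<times> A) \<le> card (dc_fix GS h g)"
    using card_mono[OF finite_dc_fix sub] card_image[OF inj] by simp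
  then show ?thesis
    using card_permutations[OF card_Block[OF B(1)] finite_Block[OF B(1)]] by (simp add: card_cartesian_product)
qed

text \<open>Union bound. Fix one \<open>y \<noteq> pt B\<close> in the block; a match of
  \<open>B\<close> yields a stabilising pair sending \<open>pt B\<close> to \<open>y\<close>. The
  preimage \<open>z\<close> of \<open>pt B\<close> has at most \<open>p * k\<close> values and its
  image under the second coordinate at most \<open>p\<close>.\<close>

lemma card_extra_match:
  assumes h: "h \<in> H" and g: "g \<in> H" and B: "B \<in> Blocks" "B \<notin> moved_blocks h"
  shows "fact p * card {\<tau> \<in> dc_fix GS h g. B \<in> matched \<tau>} \<le> p ^ 2 * k * card (dc_fix GS h g)"
proof -
  let ?E = "{\<tau> \<in> dc_fix GS h g. B \<in> matched \<tau>}"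
  let ?I = "SIGMA z:{1..p*k}. orb z"
  obtain y where y: "y \<in> B" "y \<noteq> pt B" using exists_other_point[OF B(1)] .
  define A where "A = (\<lambda>i. {\<tau> \<in> dc_fix GS h g. \<tau> (fst i) = pt B \<and>
    (\<exists>x\<in>dc_stab GS H \<tau>. fst x (pt B) = y \<and> snd x (fst i) = snd i)})"
  have finI: "finite ?I" using finite_orb by auto
  have "?E \<subseteq> (\<Union>i\<in>?I. A i)"
  proof
    fix \<tau> assume \<tau>: "\<tau> \<in> ?E"
    then have \<tau>p: "\<tau> permutes {1..p*k}" using fix_iff[OF h g] by auto
    obtain c c' where c: "(c, c') \<in> dc_stab GS H \<tau>" "c (pt B) = y"
      using stab_single[OF \<tau>p _ y(1)] \<tau> by blast
    obtain z where z: "\<tau> z = pt B" using permutes_surj[OF \<tau>p] by (metis surjD)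
    have "pt B \<in> {1..p*k}" using pt_in[OF B(1)] Blocks_sub[OF B(1)] by blast
    then have "z \<in> {1..p*k}" using permutes_in_image[OF \<tau>p, of z] z by simp
    moreover have "c' z \<in> orb z" using orb_memI[of c' z] c(1) stab_iff[OF \<tau>p] by auto
    ultimately have "(z, c' z) \<in> ?I" by auto
    moreover have "\<tau> \<in> A (z, c' z)"
      unfolding A_def using \<tau> z c by (auto intro!: bexI[of _ "(c, c')"])
    ultimately show "\<tau> \<in> (\<Union>i\<in>?I. A i)" by blast
  qed
  then have "card ?E \<le> card (\<Union>i\<in>?I. A i)"
    using finI finite_dc_fix by (intro card_mono) (auto simp: A_def)
  also have "\<dots> \<le> (\<Sum>i\<in>?I. card (A i))" by (rule card_UN_le[OF finI])
  finally have "fact p * card ?E \<le> (\<Sum>i\<in>?I. fact p * card (A i))"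
    by (simp add: sum_distrib_left[symmetric])
  also have "\<dots> \<le> (\<Sum>i\<in>?I. card (dc_fix GS h g))"
    unfolding A_def by (intro sum_mono card_prescribed_match[OF h g B y(2)])
  also have "\<dots> = card ?I * card (dc_fix GS h g)" by simp
  also have "card ?I \<le> p ^ 2 * k"
  proof -
    have "card ?I = (\<Sum>z\<in>{1..p*k}. card (orb z))" using finite_orb by (intro card_SigmaI) auto
    also have "\<dots> \<le> (\<Sum>z\<in>{1..p*k}. p)"
    proof (rule sum_mono)
      fix z assume "z \<in> {1..p*k}"
      then show "card (orb z) \<le> p" using card_orb_cases[of z] p_gt_1 by auto
    qed
    finally show ?thesis by (simp add: power2_eq_square algebra_simps)
  qed
  finally show ?thesis by simp
qed

section \<open>The number of matched blocks after one step\<close>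

lemma moved_sub_matched:
  assumes "x \<in> dc_stab GS H \<sigma>" "\<sigma> permutes {1..p*k}" "\<tau> \<in> dc_fix GS (fst x) (snd x)"
  shows "moved_blocks (fst x) \<subseteq> matched \<tau>"
proof -
  have H: "fst x \<in> H" "snd x \<in> H" using assms stab_iff by auto
  then have "\<tau> permutes {1..p*k}" "\<tau> \<circ> snd x = fst x \<circ> \<tau>" using assms(3) fix_iff by auto
  then have "x \<in> dc_stab GS H \<tau>" using H stab_iff by auto
  then show ?thesis by (auto simp: matched_def)
qed

text \<open>The chosen pair also stabilises \<tau>, so the blocks it moves stay matched and the
  excess counts the other matched blocks; exchange sums and bound each block by
  \<open>card_extra_match\<close>.\<close>

lemma sum_extra_matches:
  assumes x: "x \<in> dc_stab GS H \<sigma>" and \<sigma>: "\<sigma> permutes {1..p*k}"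
  defines "F \<equiv> dc_fix GS (fst x) (snd x)"
  shows "(\<Sum>\<tau>\<in>F. real (card (matched \<tau>)) - real (card (moved_blocks (fst x)))) \<le> err * real (card F)"
proof -
  let ?M = "moved_blocks (fst x)"
  let ?E = "\<lambda>B. {\<tau> \<in> F. B \<in> matched \<tau>}"
  have H: "fst x \<in> H" "snd x \<in> H" using x stab_iff[OF \<sigma>] by auto
  have finF: "finite F" unfolding F_def by (rule finite_dc_fix)
  have "(\<Sum>\<tau>\<in>F. real (card (matched \<tau>)) - real (card ?M)) = (\<Sum>\<tau>\<in>F. \<Sum>B\<in>Blocks - ?M. if B \<in> matched \<tau> then 1 else 0)"
  proof (rule sum.cong)
    fix \<tau> assume "\<tau> \<in> F"
    then have sub: "?M \<subseteq> matched \<tau>" using moved_sub_matched[OF x \<sigma>] by (simp add: F_def)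
    have finM: "finite ?M" using finite_Blocks by (simp add: moved_blocks_def)
    have "real (card (matched \<tau>)) - real (card ?M) = real (card (matched \<tau> - ?M))"
      using card_Diff_subset[OF finM sub] card_mono[OF finite_matched sub] by (simp add: of_nat_diff)
    also have "matched \<tau> - ?M = (Blocks - ?M) \<inter> matched \<tau>" using matched_sub by auto
    also have "real (card \<dots>) = (\<Sum>B\<in>(Blocks - ?M) \<inter> matched \<tau>. 1)" by simp
    also have "\<dots> = (\<Sum>B\<in>Blocks - ?M. if B \<in> matched \<tau> then 1 else 0)"
      using finite_Blocks by (intro sum.inter_restrict) simp
    finally show "real (card (matched \<tau>)) - real (card ?M) = (\<Sum>B\<in>Blocks - ?M. if B \<in> matched \<tau> then 1 else 0)" .
  qed simp
  also have "\<dots> = (\<Sum>B\<in>Blocks - ?M. \<Sum>\<tau>\<in>F. if B \<in> matched \<tau> then 1 else 0)"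
    by (rule sum.swap)
  also have "\<dots> = (\<Sum>B\<in>Blocks - ?M. real (card (?E B)))"
    using finF by (simp add: sum.inter_filter[symmetric])
  also have "\<dots> \<le> (\<Sum>B\<in>Blocks - ?M. real p ^ 3 / fact p * real (card F))"
  proof (rule sum_mono)
    fix B assume B: "B \<in> Blocks - ?M"
    have "real (fact p * card (?E B)) \<le> real (p ^ 2 * k * card F)"
      using card_extra_match[OF H, of B] B unfolding F_def by (simp only: of_nat_le_iff) blast
    also have "\<dots> \<le> real (p ^ 2 * p * card F)"
      using k_less by (simp only: of_nat_le_iff) simp
    finally have "fact p * real (card (?E B)) \<le> real p ^ 3 * real (card F)"
      by (simp add: power3_eq_cube power2_eq_square)
    then show "real (card (?E B)) \<le> real p ^ 3 / fact p * real (card F)"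
      by (simp add: field_simps)
  qed
  also have "\<dots> = real (card (Blocks - ?M)) * (real p ^ 3 / fact p * real (card F))" by simp
  also have "\<dots> \<le> real p * (real p ^ 3 / fact p * real (card F))"
  proof (rule mult_right_mono)
    have "card (Blocks - ?M) \<le> card Blocks" using finite_Blocks by (intro card_mono) auto
    then show "real (card (Blocks - ?M)) \<le> real p" using card_Blocks k_less by simp
  qed simp
  also have "\<dots> = err * real (card F)" by (simp add: err_def eval_nat_numeral)
  finally show ?thesis .
qed

lemma kernel_sum_le:
  assumes \<sigma>: "\<sigma> permutes {1..p*k}"
    and le: "\<And>x. x \<in> dc_stab GS H \<sigma> \<Longrightarrow>
      (\<Sum>\<tau>\<in>dc_fix GS (fst x) (snd x). f \<tau>) \<le> c x * real (card (dc_fix GS (fst x) (snd x)))"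
  shows "(\<Sum>\<tau>\<in>carrier GS. burnside_kernel GS H \<sigma> \<tau> * f \<tau>)
    \<le> (\<Sum>x\<in>dc_stab GS H \<sigma>. c x) / real (card (dc_stab GS H \<sigma>))"
proof -
  have \<sigma>c: "\<sigma> \<in> carrier GS" using \<sigma> by (simp add: sym_group_carrier)
  have "(\<Sum>\<tau>\<in>dc_fix GS (fst x) (snd x). f \<tau>) / real (card (dc_fix GS (fst x) (snd x))) \<le> c x"
    if x: "x \<in> dc_stab GS H \<sigma>" for x
    using le[OF x] card_dc_fix_pos[OF \<sigma>c x] by (simp add: divide_le_eq)
  then show ?thesis
    unfolding sum_kernel[OF \<sigma>c] by (intro divide_right_mono sum_mono) auto
qed

text \<open>Under a uniform pair, each matched block is moved independently with probability
  \<open>1 - 1 / p\<close>: a binomial generating function.\<close>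

lemma mean_stab_power:
  assumes \<sigma>: "\<sigma> permutes {1..p*k}"
  shows "(\<Sum>x\<in>dc_stab GS H \<sigma>. y ^ card (moved_blocks (fst x))) / real (card (dc_stab GS H \<sigma>))
    = (1 / real p + (1 - 1 / real p) * y) ^ card (matched \<sigma>)"
proof -
  have "(1 + (real p - 1) * y) / real p = 1 / real p + (1 - 1 / real p) * y"
    using p_gt_1 by (simp add: field_simps)
  then show ?thesis
    by (simp add: sum_stab_power[OF \<sigma>] card_stab[OF \<sigma>] power_divide[symmetric])
qed

text \<open>New matches can only lower a power of \<open>y \<le> 1\<close>, so this direction
  carries no error term.\<close>

lemma kernel_power_le:
  fixes y :: real
  assumes \<sigma>: "\<sigma> permutes {1..p*k}" and y: "0 \<le> y" "y \<le> 1"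
  shows "(\<Sum>\<tau>\<in>carrier GS. burnside_kernel GS H \<sigma> \<tau> * y ^ card (matched \<tau>))
    \<le> (1 / real p + (1 - 1 / real p) * y) ^ card (matched \<sigma>)"
  unfolding mean_stab_power[OF \<sigma>, symmetric]
proof (rule kernel_sum_le[OF \<sigma>])
  fix x assume x: "x \<in> dc_stab GS H \<sigma>"
  have "(\<Sum>\<tau>\<in>dc_fix GS (fst x) (snd x). y ^ card (matched \<tau>)) \<le> (\<Sum>\<tau>\<in>dc_fix GS (fst x) (snd x). y ^ card (moved_blocks (fst x)))"
    using moved_sub_matched[OF x \<sigma>] y finite_matched by (intro sum_mono power_decreasing card_mono) auto
  then show "(\<Sum>\<tau>\<in>dc_fix GS (fst x) (snd x). y ^ card (matched \<tau>))
      \<le> y ^ card (moved_blocks (fst x)) * real (card (dc_fix GS (fst x) (snd x)))"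
    by (simp add: mult.commute)
qed

lemma kernel_power_ge:
  fixes y :: real
  assumes \<sigma>: "\<sigma> permutes {1..p*k}" and y: "0 \<le> y" "y \<le> 1"
  shows "(1 / real p + (1 - 1 / real p) * y) ^ card (matched \<sigma>) - err
    \<le> (\<Sum>\<tau>\<in>carrier GS. burnside_kernel GS H \<sigma> \<tau> * y ^ card (matched \<tau>))"
proof -
  let ?S = "dc_stab GS H \<sigma>"
  have S: "0 < card ?S" using card_dc_stab_pos \<sigma> by (simp add: sym_group_carrier)
  \<comment> \<open>The upper estimate \<open>kernel_sum_le\<close> is applied to the negated
    function.\<close>
  have "(\<Sum>\<tau>\<in>carrier GS. burnside_kernel GS H \<sigma> \<tau> * - (y ^ card (matched \<tau>)))
    \<le> (\<Sum>x\<in>?S. err - y ^ card (moved_blocks (fst x))) / real (card ?S)"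
  proof (rule kernel_sum_le[OF \<sigma>])
    fix x assume x: "x \<in> ?S"
    let ?F = "dc_fix GS (fst x) (snd x)" and ?m = "card (moved_blocks (fst x))"
    \<comment> \<open>The left side vanishes without new matches and is at most 1 otherwise, so the
      number of new matches dominates it.\<close>
    have "y ^ ?m - y ^ card (matched \<tau>) \<le> real (card (matched \<tau>)) - real ?m" if "\<tau> \<in> ?F" for \<tau>
    proof -
      have "?m \<le> card (matched \<tau>)"
        using moved_sub_matched[OF x \<sigma> that] finite_matched by (intro card_mono)
      moreover have "y ^ ?m \<le> 1" "0 \<le> y ^ card (matched \<tau>)" using y by (auto simp: power_le_one)
      ultimately show ?thesis by (cases "?m = card (matched \<tau>)") auto
    qed
    then have "(\<Sum>\<tau>\<in>?F. y ^ ?m - y ^ card (matched \<tau>)) \<le> (\<Sum>\<tau>\<in>?F. real (card (matched \<tau>)) - real ?m)"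
      by (rule sum_mono)
    also have "\<dots> \<le> err * real (card ?F)" by (rule sum_extra_matches[OF x \<sigma>])
    finally show "(\<Sum>\<tau>\<in>?F. - (y ^ card (matched \<tau>))) \<le> (err - y ^ ?m) * real (card ?F)"
      by (simp add: sum_subtractf sum_negf algebra_simps)
  qed
  also have "\<dots> = err - (1 / real p + (1 - 1 / real p) * y) ^ card (matched \<sigma>)"
    using S by (simp add: mean_stab_power[OF \<sigma>, symmetric] sum_subtractf diff_divide_distrib)
  finally show ?thesis by (simp add: sum_negf)
qed

lemma kernel_card_le:
  assumes \<sigma>: "\<sigma> permutes {1..p*k}"
  shows "(\<Sum>\<tau>\<in>carrier GS. burnside_kernel GS H \<sigma> \<tau> * real (card (matched \<tau>)))
    \<le> (1 - 1 / real p) * real (card (matched \<sigma>)) + err"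
proof -
  let ?S = "dc_stab GS H \<sigma>"
  have S: "0 < card ?S" using card_dc_stab_pos \<sigma> by (simp add: sym_group_carrier)
  have "(\<Sum>\<tau>\<in>carrier GS. burnside_kernel GS H \<sigma> \<tau> * real (card (matched \<tau>)))
    \<le> (\<Sum>x\<in>?S. real (card (moved_blocks (fst x))) + err) / real (card ?S)"
    by (rule kernel_sum_le[OF \<sigma>])
      (use sum_extra_matches[OF _ \<sigma>] in \<open>force simp: sum_subtractf algebra_simps\<close>)
  also have "\<dots> = (1 - 1 / real p) * real (card (matched \<sigma>)) + err"
    using S by (simp add: sum.distrib sum_stab_card[OF \<sigma>] add_divide_distrib)
  finally show ?thesis .
qed

subsection \<open>Distance to stationarity\<close>

lemma carrier_permutes: "\<sigma> \<in> carrier GS \<longleftrightarrow> \<sigma> permutes {1..p*k}"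
  by (simp add: sym_group_carrier)

section \<open>Comparison with a pure death process\<close>

definition unmatched :: "(nat \<Rightarrow> nat) set" where
  "unmatched = {\<sigma> \<in> carrier GS. matched \<sigma> = {}}"

text \<open>The probability that a given matched block is lost within \<open>t\<close> steps when
  each step keeps it with probability \<open>1 - 1 / p\<close>.\<close>

definition death :: "nat \<Rightarrow> real" where
  "death t = 1 - (1 - 1 / real p) ^ t"

text \<open>The iterates, starting from 0, of the map on \<open>y\<close> that appears in the
  one-step estimates for powers.\<close>

lemma death_Suc: "death (Suc t) = 1 / real p + (1 - 1 / real p) * death t"
  using p_gt_1 by (simp add: death_def field_simps)

lemma death_bounds: "0 \<le> death t" "death t \<le> 1"
  using p_gt_1 by (auto simp: death_def power_le_one)

lemma death_0: "death 0 = 0"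
  by (simp add: death_def)

text \<open>In equilibrium the loss of matched blocks, a fraction \<open>1/p\<close> per step, balances the gain.\<close>

lemma stationary_expected_matched:
  "(\<Sum>\<sigma>\<in>carrier GS. burnside_stationary GS H \<sigma> * real (card (matched \<sigma>))) \<le> real p * err"
proof -
  let ?\<pi> = "burnside_stationary GS H" and ?K = "burnside_kernel GS H"
  let ?j = "\<lambda>\<sigma>. real (card (matched \<sigma>))"
  define E where "E = (\<Sum>\<sigma>\<in>carrier GS. ?\<pi> \<sigma> * ?j \<sigma>)"
  have "E = (\<Sum>\<tau>\<in>carrier GS. \<Sum>\<sigma>\<in>carrier GS. ?\<pi> \<sigma> * (?K \<sigma> \<tau> * ?j \<tau>))"
    unfolding E_def
    by (intro sum.cong) (simp_all add: stationary_invariant[symmetric] sum_distrib_right mult.assoc)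
  also have "\<dots> = (\<Sum>\<sigma>\<in>carrier GS. ?\<pi> \<sigma> * (\<Sum>\<tau>\<in>carrier GS. ?K \<sigma> \<tau> * ?j \<tau>))"
    by (subst sum.swap) (simp add: sum_distrib_left)
  also have "\<dots> \<le> (\<Sum>\<sigma>\<in>carrier GS. ?\<pi> \<sigma> * ((1 - 1 / real p) * ?j \<sigma> + err))"
    by (intro sum_mono mult_left_mono kernel_card_le stationary_nonneg) (simp add: carrier_permutes)
  also have "\<dots> = (\<Sum>\<sigma>\<in>carrier GS. (1 - 1 / real p) * (?\<pi> \<sigma> * ?j \<sigma>) + err * ?\<pi> \<sigma>)"
    by (intro sum.cong) (simp_all add: algebra_simps)
  also have "\<dots> = (1 - 1 / real p) * E + err"
    using stationary_sum_one by (simp add: E_def sum.distrib sum_distrib_left[symmetric])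
  finally have "E \<le> (1 - 1 / real p) * E + err" .
  then show ?thesis
    unfolding E_def[symmetric] using p_gt_1 by (simp add: field_simps)
qed

text \<open>Markov's inequality: off \<open>unmatched\<close> at least one block is matched.\<close>

lemma stationary_unmatched: "1 - real p * err \<le> (\<Sum>\<sigma>\<in>unmatched. burnside_stationary GS H \<sigma>)"
proof -
  let ?\<pi> = "burnside_stationary GS H"
  let ?j = "\<lambda>\<sigma>. real (card (matched \<sigma>))"
  have "1 = (\<Sum>\<sigma>\<in>carrier GS. ?\<pi> \<sigma>)" using stationary_sum_one by simp
  also have "\<dots> \<le> (\<Sum>\<sigma>\<in>carrier GS. ?\<pi> \<sigma> * ?j \<sigma> + (if matched \<sigma> = {} then ?\<pi> \<sigma> else 0))"
  proof (rule sum_mono)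
    fix \<sigma>
    show "?\<pi> \<sigma> \<le> ?\<pi> \<sigma> * ?j \<sigma> + (if matched \<sigma> = {} then ?\<pi> \<sigma> else 0)"
    proof (cases "matched \<sigma> = {}")
      case False
      then have "1 \<le> ?j \<sigma>" using finite_matched[of \<sigma>] by (simp add: Suc_leI card_gt_0_iff)
      then show ?thesis using mult_left_mono[of 1 "?j \<sigma>" "?\<pi> \<sigma>"] stationary_nonneg False by simp
    qed simp
  qed
  also have "\<dots> = (\<Sum>\<sigma>\<in>carrier GS. ?\<pi> \<sigma> * ?j \<sigma>) + (\<Sum>\<sigma>\<in>unmatched. ?\<pi> \<sigma>)"
    using finite_carrier by (simp add: sum.distrib unmatched_def sum.inter_filter)
  finally show ?thesis using stationary_expected_matched by simp
qed

text \<open>With trivial stabiliser, one step gives the uniform distribution. The stationary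
  distribution is nearly above it: its least value is at least \<open>1 / stab_weight\<close>,
  attained on \<open>unmatched\<close>, which carries almost all the stationary mass.\<close>

lemma tv_1_unmatched:
  assumes "\<sigma> \<in> unmatched"
  shows "tv 1 \<sigma> \<le> real p * err"
proof -
  have \<sigma>: "\<sigma> \<in> carrier GS" and \<sigma>p: "\<sigma> permutes {1..p*k}" and m: "matched \<sigma> = {}"
    using assms by (auto simp: unmatched_def carrier_permutes)
  let ?N = "real (card (carrier GS))" and ?c = "1 - real p * err"
  have Npos: "0 < ?N" using finite_carrier \<sigma> by (auto simp: card_gt_0_iff)
  have "card (dc_stab GS H \<sigma>) = 1" using card_stab[OF \<sigma>p] m by simp
  then obtain a where a: "dc_stab GS H \<sigma> = {a}" by (rule card_1_singletonE)
  have "(id, id) \<in> dc_stab GS H \<sigma>" using stab_iff[OF \<sigma>p, of "(id, id)"] H_id by simp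
  then have stab: "dc_stab GS H \<sigma> = {(id, id)}" using a by simp
  have fixid: "dc_fix GS id id = carrier GS"
    by (rule Set.set_eqI) (simp add: fix_iff[OF H_id H_id] carrier_permutes)
  have dist1: "burnside_dist GS H 1 \<sigma> \<tau> = 1 / ?N" if \<tau>: "\<tau> \<in> carrier GS" for \<tau>
  proof -
    have "(id, id) \<in> dc_stab GS H \<tau>" using stab_iff[of \<tau> "(id, id)"] \<tau> H_id by (simp add: carrier_permutes)
    then have "burnside_kernel GS H \<sigma> \<tau> = 1 / ?N"
      unfolding burnside_kernel_def stab by (simp add: fixid)
    moreover have "burnside_dist GS H 1 \<sigma> \<tau> = burnside_kernel GS H \<sigma> \<tau>"
      using \<sigma> finite_carrier by (simp add: if_distrib[of "\<lambda>x. x * _"] cong: if_cong)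
    ultimately show ?thesis by simp
  qed
  have W: "1 / stab_weight \<le> burnside_stationary GS H \<tau>" if "\<tau> \<in> carrier GS" for \<tau>
    using that card_dc_stab_pos[OF that] stab_weight_pos by (simp add: stationary_eq divide_right_mono)
  have "(\<Sum>\<tau>\<in>unmatched. burnside_stationary GS H \<tau>) = real (card unmatched) / stab_weight"
    by (subst sum.cong[OF refl, of _ _ "\<lambda>_. 1 / stab_weight"])
      (auto simp: unmatched_def stationary_eq card_stab carrier_permutes)
  also have "\<dots> \<le> ?N / stab_weight"
    using finite_carrier stab_weight_pos
    by (intro divide_right_mono of_nat_mono card_mono) (auto simp: unmatched_def)
  finally have "?c \<le> ?N / stab_weight" using stationary_unmatched by simp
  then have "?c / ?N \<le> 1 / stab_weight" using Npos by (simp add: field_simps)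
  then have "?c * burnside_dist GS H 1 \<sigma> \<tau> \<le> burnside_stationary GS H \<tau>" if "\<tau> \<in> carrier GS" for \<tau>
    using W[OF that] dist1[OF that] by (simp del: burnside_dist.simps One_nat_def)
  then have "tv 1 \<sigma> \<le> 1 - ?c"
    using err_nonneg by (intro tv_le_deficit[OF \<sigma>]) auto
  then show ?thesis by simp
qed

text \<open>Induction through the first step, each step costing one \<open>err\<close>. Time is
  shifted by one against \<open>death\<close>, because after the last match is lost one more step is
  needed to become uniform; that step costs \<open>p * err\<close>.\<close>

lemma tv_upper:
  assumes "\<sigma> \<in> carrier GS"
  shows "tv (Suc t) \<sigma> \<le> 1 - death t ^ card (matched \<sigma>) + (real t + real p) * err"
  using assms
proof (induction t arbitrary: \<sigma>)
  case 0
  show ?case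
  proof (cases "matched \<sigma> = {}")
    case True
    then show ?thesis using tv_1_unmatched[of \<sigma>] 0 by (simp add: unmatched_def)
  next
    case False
    then have "card (matched \<sigma>) \<noteq> 0" using finite_matched by simp
    \<comment> \<open>Since \<open>death 0 = 0\<close> and some block is matched, the claimed bound
      is at least 1.\<close>
    moreover have "0 \<le> real p * err" using err_nonneg by simp
    ultimately show ?thesis using tv_le_one[OF 0, of 1] by (simp add: death_0 power_0_left)
  qed
next
  case (Suc t)
  let ?K = "burnside_kernel GS H \<sigma>"
  have \<sigma>p: "\<sigma> permutes {1..p*k}" using Suc.prems carrier_permutes by simp
  have "tv (Suc (Suc t)) \<sigma> \<le> (\<Sum>\<tau>\<in>carrier GS. ?K \<tau> * tv (Suc t) \<tau>)"
    by (rule tv_Suc_le[OF Suc.prems])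
  also have "\<dots> \<le> (\<Sum>\<tau>\<in>carrier GS. ?K \<tau> * (1 - death t ^ card (matched \<tau>) + (real t + real p) * err))"
    by (intro sum_mono mult_left_mono Suc.IH kernel_nonneg)
  also have "\<dots> = (\<Sum>\<tau>\<in>carrier GS. ?K \<tau> * (1 + (real t + real p) * err) - ?K \<tau> * death t ^ card (matched \<tau>))"
    by (intro sum.cong) (simp_all add: algebra_simps)
  also have "\<dots> = 1 + (real t + real p) * err - (\<Sum>\<tau>\<in>carrier GS. ?K \<tau> * death t ^ card (matched \<tau>))"
    using kernel_sum_one[OF Suc.prems] by (simp add: sum_subtractf sum_distrib_right[symmetric])
  also have "\<dots> \<le> 1 + (real t + real p) * err - (death (Suc t) ^ card (matched \<sigma>) - err)"
    using kernel_power_ge[OF \<sigma>p death_bounds, of t] by (simp add: death_Suc)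
  finally show ?case by (simp add: algebra_simps)
qed

text \<open>Iterates the error-free estimate. At time 0 the right side is a power of 0, which equals
  1 exactly when no block is matched.\<close>

lemma dist_unmatched_upper:
  assumes "\<sigma> \<in> carrier GS"
  shows "(\<Sum>\<tau>\<in>unmatched. burnside_dist GS H t \<sigma> \<tau>) \<le> death t ^ card (matched \<sigma>)"
  using assms
proof (induction t arbitrary: \<sigma>)
  case 0
  have fin: "finite unmatched" using finite_carrier by (simp add: unmatched_def)
  show ?case
  proof (cases "matched \<sigma> = {}")
    case True
    then show ?thesis using fin by simp
  next
    case False
    then have "\<sigma> \<notin> unmatched" by (simp add: unmatched_def)
    then show ?thesis using fin death_bounds by simp
  qed
next
  case (Suc t)
  let ?K = "burnside_kernel GS H \<sigma>"
  have \<sigma>p: "\<sigma> permutes {1..p*k}" using Suc.prems carrier_permutes by simp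
  have "(\<Sum>\<tau>\<in>unmatched. burnside_dist GS H (Suc t) \<sigma> \<tau>)
      = (\<Sum>\<tau>\<in>unmatched. \<Sum>\<rho>\<in>carrier GS. ?K \<rho> * burnside_dist GS H t \<rho> \<tau>)"
    by (intro sum.cong refl dist_Suc[OF Suc.prems]) (simp add: unmatched_def)
  also have "\<dots> = (\<Sum>\<rho>\<in>carrier GS. ?K \<rho> * (\<Sum>\<tau>\<in>unmatched. burnside_dist GS H t \<rho> \<tau>))"
    by (subst sum.swap) (simp add: sum_distrib_left)
  also have "\<dots> \<le> (\<Sum>\<rho>\<in>carrier GS. ?K \<rho> * death t ^ card (matched \<rho>))"
    by (intro sum_mono mult_left_mono Suc.IH kernel_nonneg)
  also have "\<dots> \<le> death (Suc t) ^ card (matched \<sigma>)"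
    using kernel_power_le[OF \<sigma>p death_bounds, of t] by (simp add: death_Suc)
  finally show ?case .
qed

text \<open>The pairs \<open>(h, h)\<close> stabilise the identity, so it has the largest possible
  number of matched blocks.\<close>

lemma matched_id: "matched id = Blocks"
proof
  show "Blocks \<subseteq> matched id"
  proof
    fix B assume B: "B \<in> Blocks"
    obtain y where y: "y \<in> B" "y \<noteq> pt B" using exists_other_point[OF B] .
    have "y \<in> (\<lambda>h. h (pt B)) ` H" using y orb_pt[OF B] by (simp add: orb_def)
    then obtain h where h: "y = h (pt B)" "h \<in> H" by (rule imageE)
    have "(h, h) \<in> dc_stab GS H id" using h stab_iff[OF permutes_id] by simp
    moreover have "B \<in> moved_blocks (fst (h, h))" using h y B by (simp add: moved_blocks_def)
    ultimately show "B \<in> matched id" unfolding matched_def by blast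
  qed
qed (rule matched_sub)

text \<open>Start at the identity and test with the event \<open>unmatched\<close>, which is likely
  in equilibrium.\<close>

lemma burnside_d_lower:
  "1 - (1 - (1 - 1 / real p) ^ nat \<lfloor>s\<rfloor>) ^ k - real p * (real p ^ 4 / fact p) \<le> burnside_d GS H s"
proof -
  let ?t = "nat \<lfloor>s\<rfloor>"
  have id: "id \<in> carrier GS" by (simp add: carrier_permutes permutes_id)
  have "1 - death ?t ^ k - real p * err \<le> tv ?t id"
    using tv_ge_diff[OF id, of unmatched ?t] stationary_unmatched dist_unmatched_upper[OF id, of ?t]
    by (simp add: unmatched_def matched_id card_Blocks)
  also have "\<dots> \<le> burnside_d GS H s"
    unfolding burnside_d_def tv_def[symmetric] using finite_carrier id by (intro Max_ge) auto
  finally show ?thesis unfolding death_def err_def .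
qed

lemma burnside_d_upper:
  "burnside_d GS H s \<le> 1 - (1 - (1 - 1 / real p) ^ (nat \<lfloor>s\<rfloor> - 1)) ^ k
    + (real (nat \<lfloor>s\<rfloor>) + real p) * (real p ^ 4 / fact p)"
proof -
  let ?t = "nat \<lfloor>s\<rfloor>"
  have "tv ?t \<sigma> \<le> 1 - death (?t - 1) ^ k + (real ?t + real p) * err" if \<sigma>: "\<sigma> \<in> carrier GS" for \<sigma>
  proof (cases ?t)
    \<comment> \<open>Here \<open>?t - 1\<close> truncates to 0; as \<open>death 0 = 0\<close> and
      \<open>k \<ge> 1\<close>, the bound is trivially at least 1.\<close>
    case 0
    moreover have "0 \<le> real p * err" using err_nonneg by simp
    ultimately show ?thesis using tv_le_one[OF \<sigma>, of 0] k_pos by (simp add: death_0 power_0_left)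
  next
    case (Suc t)
    have "tv (Suc t) \<sigma> \<le> 1 - death t ^ card (matched \<sigma>) + (real t + real p) * err"
      by (rule tv_upper[OF \<sigma>])
    also have "\<dots> \<le> 1 - death t ^ k + (real (Suc t) + real p) * err"
      using power_decreasing[OF card_matched_le[of \<sigma>] death_bounds[of t]] err_nonneg
      by (simp add: algebra_simps)
    finally show ?thesis using Suc by simp
  qed
  then show ?thesis
    unfolding burnside_d_def tv_def[symmetric] death_def[symmetric] err_def[symmetric]
    using finite_carrier one_closed by (subst Max_le_iff) auto
qed

end

section \<open>Asymptotics\<close>

text \<open>Taking logarithms, \<open>T * ln (1 - 1 / p)\<close> is \<open>- s\<close> up to an
  error of order \<open>ln p / p\<close>, because \<open>T\<close> is \<open>p * s\<close> up to a
  constant and \<open>s\<close> is at most \<open>ln p + C\<close>. The tolerance 2 admits both the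
  rounded time and its predecessor.\<close>

lemma survival_limit:
  fixes p T :: "nat \<Rightarrow> nat" and s :: "nat \<Rightarrow> real"
  assumes p: "filterlim p at_top sequentially"
    and s: "\<forall>\<^sub>F m in sequentially. 0 \<le> s m \<and> s m \<le> ln (real (p m)) + C"
    and T: "\<forall>\<^sub>F m in sequentially. \<bar>real (T m) - real (p m) * s m\<bar> \<le> 2"
  shows "(\<lambda>m. (1 - 1 / real (p m)) ^ T m * exp (s m)) \<longlonglongrightarrow> 1"
proof -
  have pr: "filterlim (\<lambda>m. real (p m)) at_top sequentially"
    using p by (rule filterlim_compose[OF filterlim_real_sequentially])
  \<comment> \<open>The error bound obtained below:
    \<open>(P * (ln P + C) + 2) * (2 / P\<^sup>2)\<close> from the quadratic term of the logarithm,
    and \<open>2 / P\<close> from rounding.\<close>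
  define g where "g = (\<lambda>P::real. 2 * (ln P + C) / P + 4 / P\<^sup>2 + 2 / P)"
  have "(g \<longlongrightarrow> 0) at_top" unfolding g_def by real_asymp
  then have g0: "(\<lambda>m. g (real (p m))) \<longlonglongrightarrow> 0" using pr by (rule filterlim_compose)
  let ?e = "\<lambda>m. real (T m) * ln (1 - 1 / real (p m)) + s m"
  have p2: "\<forall>\<^sub>F m in sequentially. 2 \<le> p m" using p by (simp add: filterlim_at_top)
  have "\<forall>\<^sub>F m in sequentially. norm (?e m) \<le> norm (g (real (p m))) * 1"
    using s T p2
  proof eventually_elim
    case (elim m)
    define P where "P = real (p m)"
    have P: "2 \<le> P" using elim by (simp add: P_def)
    have "\<bar>ln (1 + - (1 / P)) - - (1 / P)\<bar> \<le> 2 * (- (1 / P))\<^sup>2"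
      using P by (intro abs_ln_one_plus_x_minus_x_bound) (auto simp: field_simps)
    then have ln: "\<bar>ln (1 - 1 / P) + 1 / P\<bar> \<le> 2 / P\<^sup>2" by (simp add: power_divide)
    have TP: "real (T m) \<le> P * (ln P + C) + 2"
    proof -
      have "P * s m \<le> P * (ln P + C)" using elim P by (intro mult_left_mono) (auto simp: P_def)
      then show ?thesis using elim(2) unfolding P_def by linarith
    qed
    have "?e m = real (T m) * (ln (1 - 1 / P) + 1 / P) - (real (T m) - P * s m) / P"
      using P by (simp add: P_def field_simps)
    then have "\<bar>?e m\<bar> \<le> \<bar>real (T m) * (ln (1 - 1 / P) + 1 / P)\<bar> + \<bar>(real (T m) - P * s m) / P\<bar>"
      by (simp only: abs_triangle_ineq4)
    also have "\<dots> = real (T m) * \<bar>ln (1 - 1 / P) + 1 / P\<bar> + \<bar>real (T m) - P * s m\<bar> / P"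
      using P by (simp add: abs_mult)
    also have "\<dots> \<le> (P * (ln P + C) + 2) * (2 / P\<^sup>2) + 2 / P"
      using P elim TP ln by (intro add_mono mult_mono divide_right_mono) (auto simp: P_def)
    also have "\<dots> = g P" using P by (simp add: g_def field_simps power2_eq_square)
    finally show ?case by (simp add: P_def)
  qed
  then have "?e \<longlonglongrightarrow> 0" by (rule tendsto_0_le[OF g0])
  then have "(\<lambda>m. exp (?e m)) \<longlonglongrightarrow> exp 0" by (rule tendsto_exp)
  moreover have "\<forall>\<^sub>F m in sequentially. exp (?e m) = (1 - 1 / real (p m)) ^ T m * exp (s m)"
    using p2
  proof eventually_elim
    case (elim m)
    then have "0 < 1 - 1 / real (p m)" by simp
    then show ?case by (simp add: exp_add exp_of_nat_mult)
  qed
  ultimately show ?thesis by (simp add: tendsto_cong)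
qed

text \<open>Poisson-type limit: \<open>y\<close> tends to 0, so \<open>k * ln (1 - y)\<close> lies
  between \<open>- k * y\<close> and that value less a vanishing correction.\<close>

lemma tendsto_one_minus_power_exp:
  fixes y :: "nat \<Rightarrow> real" and k :: "nat \<Rightarrow> nat"
  assumes k: "filterlim k at_top sequentially" and lim: "(\<lambda>m. real (k m) * y m) \<longlonglongrightarrow> a"
    and pos: "\<And>m. 0 \<le> y m"
  shows "(\<lambda>m. (1 - y m) ^ k m) \<longlonglongrightarrow> exp (- a)"
proof -
  have kr: "filterlim (\<lambda>m. real (k m)) at_top sequentially"
    using k by (rule filterlim_compose[OF filterlim_real_sequentially])
  have kpos: "\<forall>\<^sub>F m in sequentially. 0 < k m"
    using k[unfolded filterlim_at_top, rule_format, of 1] by eventually_elim simp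
  have "(\<lambda>m. real (k m) * y m / real (k m)) \<longlonglongrightarrow> 0"
    using lim kr by (rule real_tendsto_divide_at_top)
  moreover have "\<forall>\<^sub>F m in sequentially. real (k m) * y m / real (k m) = y m"
    using kpos by eventually_elim simp
  ultimately have y0: "y \<longlonglongrightarrow> 0" by (simp add: tendsto_cong)
  have small: "\<forall>\<^sub>F m in sequentially. y m < 1 / 2"
    using order_tendstoD(2)[OF y0, of "1 / 2"] by simp
  let ?l = "\<lambda>m. real (k m) * ln (1 - y m)"
  have "?l \<longlonglongrightarrow> - a"
  proof (rule tendsto_sandwich)
    have "(\<lambda>m. - (real (k m) * y m) - 2 * (real (k m) * y m) * y m) \<longlonglongrightarrow> - a - 2 * a * 0"
      by (intro tendsto_intros lim y0)
    then show "(\<lambda>m. - (real (k m) * y m) - 2 * (real (k m) * y m) * y m) \<longlonglongrightarrow> - a" by simp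
    show "(\<lambda>m. - (real (k m) * y m)) \<longlonglongrightarrow> - a" by (intro tendsto_intros lim)
    show "\<forall>\<^sub>F m in sequentially. - (real (k m) * y m) - 2 * (real (k m) * y m) * y m \<le> ?l m"
      using small
    proof eventually_elim
      case (elim m)
      then have "real (k m) * (- y m - 2 * (y m)\<^sup>2) \<le> ?l m"
        using pos[of m] by (intro mult_left_mono ln_one_minus_pos_lower_bound) auto
      then show ?case by (simp add: algebra_simps power2_eq_square)
    qed
    show "\<forall>\<^sub>F m in sequentially. ?l m \<le> - (real (k m) * y m)"
      using small
    proof eventually_elim
      case (elim m)
      then have "?l m \<le> real (k m) * - y m"
        using pos[of m] by (intro mult_left_mono ln_one_minus_pos_upper_bound) auto
      then show ?case by simp
    qed
  qed
  then have "(\<lambda>m. exp (?l m)) \<longlonglongrightarrow> exp (- a)" by (rule tendsto_exp)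
  moreover have "\<forall>\<^sub>F m in sequentially. exp (?l m) = (1 - y m) ^ k m"
    using small by eventually_elim (simp add: exp_of_nat_mult)
  ultimately show ?thesis by (simp add: tendsto_cong)
qed

text \<open>Sandwiches the distance between the two bounds. Quantifying the last hypothesis over
  \<open>T\<close> covers both exponents, the rounded time and its predecessor, and leaves only the
  behaviour of \<open>k\<close> to each regime.\<close>

lemma burnside_d_limit:
  fixes p k :: "nat \<Rightarrow> nat" and H :: "nat \<Rightarrow> (nat \<Rightarrow> nat) set" and s :: "nat \<Rightarrow> real"
  assumes S: "\<And>m. sylow_sym (p m) (k m) (H m)"
    and p: "filterlim p at_top sequentially"
    and s: "\<forall>\<^sub>F m in sequentially. 0 \<le> s m \<and> s m \<le> ln (real (p m)) + C"
    and L: "\<And>T. (\<lambda>m. (1 - 1 / real (p m)) ^ T m * exp (s m)) \<longlonglongrightarrow> 1 \<Longrightarrow>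
      (\<lambda>m. (1 - (1 - 1 / real (p m)) ^ T m) ^ k m) \<longlonglongrightarrow> L"
  shows "(\<lambda>m. burnside_d (sym_group (p m * k m)) (H m) (real (p m) * s m)) \<longlonglongrightarrow> 1 - L"
proof -
  let ?T = "\<lambda>m. nat \<lfloor>real (p m) * s m\<rfloor>"
  let ?err = "\<lambda>n::nat. real n ^ 4 / fact n"
  have T0: "\<forall>\<^sub>F m in sequentially. \<bar>real (?T m) - real (p m) * s m\<bar> \<le> 1"
    using s by eventually_elim (simp add: of_nat_nat, linarith)
  then have T1: "\<forall>\<^sub>F m in sequentially. \<bar>real (?T m) - real (p m) * s m\<bar> \<le> 2"
    by eventually_elim simp
  have pred: "\<bar>real (n - 1) - y\<bar> \<le> 2" if "\<bar>real n - y\<bar> \<le> 1" for n y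
    using that by (cases n) (auto simp: abs_le_iff)
  have T2: "\<forall>\<^sub>F m in sequentially. \<bar>real (?T m - 1) - real (p m) * s m\<bar> \<le> 2"
    using T0 by eventually_elim (rule pred)
  have L1: "(\<lambda>m. (1 - (1 - 1 / real (p m)) ^ ?T m) ^ k m) \<longlonglongrightarrow> L"
    by (rule L, rule survival_limit[OF p s T1])
  have L2: "(\<lambda>m. (1 - (1 - 1 / real (p m)) ^ (?T m - 1)) ^ k m) \<longlonglongrightarrow> L"
    by (rule L, rule survival_limit[OF p s T2])
  \<comment> \<open>The polynomial factor, enlarged to dominate time plus \<open>p\<close>, is
    beaten by the factorial: compare both with \<open>2 ^ n\<close>.\<close>
  have small: "(\<lambda>n. (2 * real n + real n * (ln (real n) + C) + 2) * ?err n) \<longlonglongrightarrow> 0"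
  proof -
    have "(\<lambda>n. (2 * real n + real n * (ln (real n) + C) + 2) * real n ^ 4 / 2 ^ n) \<longlonglongrightarrow> 0"
      by real_asymp
    moreover have "(\<lambda>n. 2 ^ n / fact n :: real) \<longlonglongrightarrow> 0"
      using summable_LIMSEQ_zero[OF summable_exp[of "2::real"]] by (simp add: divide_inverse mult.commute)
    ultimately have "(\<lambda>n. (2 * real n + real n * (ln (real n) + C) + 2) * real n ^ 4 / 2 ^ n * (2 ^ n / fact n)) \<longlonglongrightarrow> 0"
      using tendsto_mult by fastforce
    then show ?thesis by simp
  qed
  have E2: "(\<lambda>m. (real (?T m) + real (p m)) * ?err (p m)) \<longlonglongrightarrow> 0"
  proof (rule tendsto_sandwich[OF _ _ tendsto_const filterlim_compose[OF small p]])
    show "\<forall>\<^sub>F m in sequentially. (real (?T m) + real (p m)) * ?err (p m)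
      \<le> (2 * real (p m) + real (p m) * (ln (real (p m)) + C) + 2) * ?err (p m)"
      using s T1
    proof eventually_elim
      case (elim m)
      have "real (p m) * s m \<le> real (p m) * (ln (real (p m)) + C)"
        using elim by (intro mult_left_mono) auto
      then show ?case using elim(2) by (intro mult_right_mono) (auto simp: abs_le_iff)
    qed
  qed auto
  have E1: "(\<lambda>m. real (p m) * ?err (p m)) \<longlonglongrightarrow> 0"
    by (rule tendsto_sandwich[OF _ _ tendsto_const E2])
      (auto intro!: always_eventually mult_right_mono divide_right_mono)
  show ?thesis
  proof (rule tendsto_sandwich)
    show "\<forall>\<^sub>F m in sequentially. 1 - (1 - (1 - 1 / real (p m)) ^ ?T m) ^ k m - real (p m) * ?err (p m)
        \<le> burnside_d (sym_group (p m * k m)) (H m) (real (p m) * s m)"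
      using sylow_sym.burnside_d_lower[OF S] by (intro always_eventually) blast
    show "\<forall>\<^sub>F m in sequentially. burnside_d (sym_group (p m * k m)) (H m) (real (p m) * s m)
        \<le> 1 - (1 - (1 - 1 / real (p m)) ^ (?T m - 1)) ^ k m + (real (?T m) + real (p m)) * ?err (p m)"
      using sylow_sym.burnside_d_upper[OF S] by (intro always_eventually) blast
    show "(\<lambda>m. 1 - (1 - (1 - 1 / real (p m)) ^ ?T m) ^ k m - real (p m) * ?err (p m)) \<longlonglongrightarrow> 1 - L"
      using tendsto_diff[OF tendsto_diff[OF tendsto_const L1] E1] by simp
    show "(\<lambda>m. 1 - (1 - (1 - 1 / real (p m)) ^ (?T m - 1)) ^ k m + (real (?T m) + real (p m)) * ?err (p m)) \<longlonglongrightarrow> 1 - L"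
      using tendsto_add[OF tendsto_diff[OF tendsto_const L2] E2] by simp
  qed
qed

text \<open>Both regimes are instances of \<open>burnside_d_limit\<close>, with rescaled time
  \<open>s = c\<close> for constant \<open>k\<close> and \<open>s = ln k + c\<close> for growing
  \<open>k\<close>.\<close>

theorem theorem1p1:
  fixes p k :: "nat \<Rightarrow> nat" and H :: "nat \<Rightarrow> (nat \<Rightarrow> nat) set"
  assumes p_prime: "\<And>m. Factorial_Ring.prime (p m)"
    and p_lim: "filterlim p at_top sequentially"
    and k_pos: "\<And>m. 1 \<le> k m"
    and k_less: "\<And>m. k m < p m"
    and sylow: "\<And>m. sylow_subgroup (p m) (sym_group (p m * k m)) (H m)"
  defines "d \<equiv> \<lambda>m. burnside_d (sym_group (p m * k m)) (H m)"
  shows "(\<forall>k0. (\<forall>\<^sub>F m in sequentially. k m = k0) \<longrightarrow>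
            (\<forall>c::real. c \<ge> 0 \<longrightarrow>
               (\<lambda>m. d m (c * real (p m))) \<longlonglongrightarrow> 1 - (1 - exp (- c)) ^ k0))
       \<and> (filterlim k at_top sequentially \<longrightarrow>
            (\<forall>c::real.
               (\<lambda>m. d m (real (p m) * ln (real (k m)) + c * real (p m)))
                 \<longlonglongrightarrow> 1 - exp (- exp (- c))))"
proof (intro conjI allI impI)
  have S: "sylow_sym (p m) (k m) (H m)" for m
    by (simp add: sylow_sym_def p_prime k_pos[simplified] k_less sylow)
  have p1: "1 \<le> p m" for m using prime_gt_1_nat[OF p_prime[of m]] by simp
  have nonneg: "0 \<le> (1 - 1 / real (p m)) ^ n" for m n
    using p1[of m] by (intro zero_le_power) simp
  {
    fix k0 and c :: real
    assume ev: "\<forall>\<^sub>F m in sequentially. k m = k0" and c: "0 \<le> c"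
    have "(\<lambda>m. d m (real (p m) * c)) \<longlonglongrightarrow> 1 - (1 - exp (- c)) ^ k0"
      unfolding d_def
    proof (rule burnside_d_limit[OF S p_lim, where C = c])
      show "\<forall>\<^sub>F m in sequentially. 0 \<le> c \<and> c \<le> ln (real (p m)) + c"
        using c p1 by (intro always_eventually) auto
    next
      fix T assume "(\<lambda>m. (1 - 1 / real (p m)) ^ T m * exp c) \<longlonglongrightarrow> 1"
      then have "(\<lambda>m. (1 - 1 / real (p m)) ^ T m * exp c * exp (- c)) \<longlonglongrightarrow> 1 * exp (- c)"
        by (intro tendsto_intros)
      then have "(\<lambda>m. (1 - 1 / real (p m)) ^ T m) \<longlonglongrightarrow> exp (- c)"
        by (simp add: mult.assoc exp_add[symmetric])
      then have "(\<lambda>m. (1 - (1 - 1 / real (p m)) ^ T m) ^ k0) \<longlonglongrightarrow> (1 - exp (- c)) ^ k0"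
        by (intro tendsto_intros)
      moreover have "\<forall>\<^sub>F m in sequentially. (1 - (1 - 1 / real (p m)) ^ T m) ^ k0
          = (1 - (1 - 1 / real (p m)) ^ T m) ^ k m"
        using ev by eventually_elim simp
      ultimately show "(\<lambda>m. (1 - (1 - 1 / real (p m)) ^ T m) ^ k m) \<longlonglongrightarrow> (1 - exp (- c)) ^ k0"
        by (rule Lim_transform_eventually)
    qed
    then show "(\<lambda>m. d m (c * real (p m))) \<longlonglongrightarrow> 1 - (1 - exp (- c)) ^ k0"
      by (simp add: mult.commute)
  }
  {
    fix c :: real
    assume k_lim: "filterlim k at_top sequentially"
    have kr: "filterlim (\<lambda>m. real (k m)) at_top sequentially"
      using k_lim by (rule filterlim_compose[OF filterlim_real_sequentially])
    have "filterlim (\<lambda>m. ln (real (k m))) at_top sequentially"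
      using kr by (rule filterlim_compose[OF ln_at_top])
    \<comment> \<open>Makes the time nonnegative for all large \<open>m\<close>, also when
      \<open>c\<close> is negative.\<close>
    then have big: "\<forall>\<^sub>F m in sequentially. - c \<le> ln (real (k m))"
      by (simp add: filterlim_at_top)
    have "(\<lambda>m. d m (real (p m) * (ln (real (k m)) + c))) \<longlonglongrightarrow> 1 - exp (- exp (- c))"
      unfolding d_def
    proof (rule burnside_d_limit[OF S p_lim, where C = c])
      show "\<forall>\<^sub>F m in sequentially. 0 \<le> ln (real (k m)) + c \<and> ln (real (k m)) + c \<le> ln (real (p m)) + c"
        using big
      proof eventually_elim
        case (elim m)
        have "ln (real (k m)) \<le> ln (real (p m))"
          using k_pos[of m] k_less[of m] by simp
        then show ?case using elim by simp
      qed
    next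
      fix T assume "(\<lambda>m. (1 - 1 / real (p m)) ^ T m * exp (ln (real (k m)) + c)) \<longlonglongrightarrow> 1"
      then have "(\<lambda>m. (1 - 1 / real (p m)) ^ T m * exp (ln (real (k m)) + c) * exp (- c)) \<longlonglongrightarrow> 1 * exp (- c)"
        by (intro tendsto_intros)
      \<comment> \<open>The factors \<open>exp c\<close> and \<open>exp (- c)\<close> cancel and
        leave \<open>k\<close> times the survival probability, the quantity whose limit the
        Poisson-type lemma needs.\<close>
      moreover have "(1 - 1 / real (p m)) ^ T m * exp (ln (real (k m)) + c) * exp (- c)
          = real (k m) * (1 - 1 / real (p m)) ^ T m" for m
        using k_pos[of m] by (simp add: exp_add exp_minus)
      ultimately have "(\<lambda>m. real (k m) * (1 - 1 / real (p m)) ^ T m) \<longlonglongrightarrow> exp (- c)"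
        by simp
      then show "(\<lambda>m. (1 - (1 - 1 / real (p m)) ^ T m) ^ k m) \<longlonglongrightarrow> exp (- exp (- c))"
        by (intro tendsto_one_minus_power_exp[OF k_lim]) (simp_all add: nonneg)
    qed
    then show "(\<lambda>m. d m (real (p m) * ln (real (k m)) + c * real (p m))) \<longlonglongrightarrow> 1 - exp (- exp (- c))"
      by (simp add: algebra_simps)
  }
qed

end
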